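(* Let $\mathrm{M}$ be a loopless matroid on a finite set $E$. The graded linear map $$\mathrm{H}(\mathrm{M})\longrightarrow\mathrm{CH}(\mathrm{M}),\qquad y_F\longmapsto y_F,$$ from the graded Möbius algebra of $\mathrm{M}$ to the augmented Chow ring of $\mathrm{M}$ is an injective homomorphism of graded algebras.
   Context: Matroids. A matroid $\mathrm{M}$ on a finite set $E$ is a nonempty collection of subsets of $E$, called flats, such that (1) the intersection of any two flats is a flat; (2) for any flat $F$, any element of $E\setminus F$ is contained in exactly one flat that is minimal among the flats strictly containing $F$. It is loopless if $\varnothing$ is a flat. A flat is proper if it is not $E$. The rank $\mathrm{rk}_\mathrm{M}(F)$ of a flat $F$ is the common cardinality of the maximal chains of flats strictly contained in $F$. The flats form a lattice $\mathscr{L}(\mathrm{M})$ with join $\vee$; $\mathscr{L}^k(\mathrm{M})$ is the set of flats of rank $k$. The closure $\mathrm{cl}_\mathrm{M}(S)$ of $S\subseteq E$ is the smallest flat containing $S$; $I\subseteq E$ is independent if the rank of $\mathrm{cl}_\mathrm{M}(I)$ is $|I|$; a basis of a flat $F$ is an independent set $I$ with $\mathrm{cl}_\mathrm{M}(I)=F$. Augmented Chow ring. $\mathrm{CH}(\mathrm{M})$ is the quotient of $\mathbb{Q}[y_i\mid i\in E]\otimes\mathbb{Q}[x_F\mid F\text{ a proper flat}]$ by the linear forms $y_i-\sum_{i\notin F}x_F$ ($i\in E$), the monomials $x_{F_1}x_{F_2}$ ($F_1,F_2$ incomparable proper flats) and the monomials $y_ix_F$ ($i\in E$, $F$ a proper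 flat not containing $i$); all variables have degree 1. For a flat $F$, the element $y_F:=\prod_{i\in I}y_i\in\mathrm{CH}(\mathrm{M})$, for a basis $I$ of $F$, does not depend on the choice of $I$. Graded Möbius algebra. $\mathrm{H}(\mathrm{M})=\bigoplus_{k\ge0}\mathrm{H}^k(\mathrm{M})$, where $\mathrm{H}^k(\mathrm{M})=\bigoplus_{F\in\mathscr{L}^k(\mathrm{M})}\mathbb{Q}\,y_F$ is the vector space with basis the formal symbols $y_F$, with multiplication $y_{F_1}y_{F_2}=y_{F_1\vee F_2}$ if $\mathrm{rk}_\mathrm{M}(F_1)+\mathrm{rk}_\mathrm{M}(F_2)=\mathrm{rk}_\mathrm{M}(F_1\vee F_2)$, and $y_{F_1}y_{F_2}=0$ if $\mathrm{rk}_\mathrm{M}(F_1)+\mathrm{rk}_\mathrm{M}(F_2)>\mathrm{rk}_\mathrm{M}(F_1\vee F_2)$. *)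

theory Defs
  imports "HOL-Algebra.Algebra" "HOL-Algebra.Algebraic_Closure_Type" "HOL-Library.Poly_Mapping"
begin

section \<open>Matroids, presented by their flats\<close>

locale matroid =
  fixes E :: "'a set" and M :: "'a set set"
  assumes finite_ground: "finite E"
    and flat_subset: "F \<in> M \<Longrightarrow> F \<subseteq> E"
    and flats_nonempty: "M \<noteq> {}"
    and flat_Int: "F \<in> M \<Longrightarrow> G \<in> M \<Longrightarrow> F \<inter> G \<in> M"
    and flat_cover: "F \<in> M \<Longrightarrow> i \<in> E - F \<Longrightarrow>
      \<exists>!G. G \<in> M \<and> F \<subset> G \<and> \<not> (\<exists>G'\<in>M. F \<subset> G' \<and> G' \<subset> G) \<and> i \<in> G"

locale loopless_matroid = matroid +
  assumes loopless: "{} \<in> M"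

text \<open>
  The common cardinality of the maximal chains of flats strictly contained in \<open>F\<close>;
  \<open>F\<close> itself is not a member of these chains, so the least flat has rank 0.
\<close>

definition matroid_rank :: "'a set set \<Rightarrow> 'a set \<Rightarrow> nat" where
  "matroid_rank M F = (THE k. \<forall>C. subset.maxchain {G \<in> M. G \<subset> F} C \<longrightarrow> card C = k)"

text \<open>
  For subsets \<open>S\<close> of the ground set, the hull is the least flat containing \<open>S\<close>,
  since finite intersections of flats are flats.
\<close>

definition matroid_closure :: "'a set set \<Rightarrow> 'a set \<Rightarrow> 'a set" where
  "matroid_closure M S = (\<lambda>F. F \<in> M) hull S"

definition flat_join :: "'a set set \<Rightarrow> 'a set \<Rightarrow> 'a set \<Rightarrow> 'a set" where
  "flat_join M F G = matroid_closure M (F \<union> G)"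

definition matroid_indep :: "'a set \<Rightarrow> 'a set set \<Rightarrow> 'a set \<Rightarrow> bool" where
  "matroid_indep E M I \<longleftrightarrow> I \<subseteq> E \<and> matroid_rank M (matroid_closure M I) = card I"

definition flat_basis :: "'a set \<Rightarrow> 'a set set \<Rightarrow> 'a set \<Rightarrow> 'a set \<Rightarrow> bool" where
  "flat_basis E M F I \<longleftrightarrow> matroid_indep E M I \<and> matroid_closure M I = F"


section \<open>Graded algebras\<close>

text \<open>
  Commutative algebras \<open>A\<close> over \<open>R\<close> that are the internal direct sum of the
  submodules \<open>gr k\<close>, with \<open>gr i \<cdot> gr j \<subseteq> gr (i + j)\<close>.
\<close>

locale graded_algebra = algebra R A
  for R :: "('r, 's) ring_scheme" and A :: "('r, 'b, 't) module_scheme" (structure) +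
  fixes gr :: "nat \<Rightarrow> 'b set"
  assumes gr_submodule: "submodule (gr k) R A"
    and gr_one: "\<one>\<^bsub>A\<^esub> \<in> gr 0"
    and gr_mult: "x \<in> gr i \<Longrightarrow> y \<in> gr j \<Longrightarrow> x \<otimes>\<^bsub>A\<^esub> y \<in> gr (i + j)"
    and gr_direct_sum: "x \<in> carrier A \<Longrightarrow>
      \<exists>!c. (\<forall>k. c k \<in> gr k) \<and> finite {k. c k \<noteq> \<zero>\<^bsub>A\<^esub>} \<and>
           x = finsum A c {k. c k \<noteq> \<zero>\<^bsub>A\<^esub>}"

locale graded_algebra_hom =
  dom: graded_algebra R A grA + cod: graded_algebra R B grB
  for R :: "('r, 's) ring_scheme"
    and A :: "('r, 'b, 't) module_scheme" and grA
    and B :: "('r, 'c, 'u) module_scheme" and grB +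
  fixes h :: "'b \<Rightarrow> 'c"
  assumes hom_ring: "h \<in> ring_hom A B"
    and hom_smult: "c \<in> carrier R \<Longrightarrow> x \<in> carrier A \<Longrightarrow> h (c \<odot>\<^bsub>A\<^esub> x) = c \<odot>\<^bsub>B\<^esub> h x"
    and hom_graded: "x \<in> grA k \<Longrightarrow> h x \<in> grB k"

abbreviation rat_ring :: "rat ring" where
  "rat_ring \<equiv> ring_of_type_algebra"


section \<open>Polynomial rings over the rationals\<close>

text \<open>
  Monomials are finitely supported exponent vectors and polynomials are finitely supported
  families of coefficients indexed by monomials; the product of \<^theory>\<open>HOL-Library.Poly_Mapping\<close>
  is then the product of polynomials.
\<close>

type_synonym 'v rat_mpoly = "('v \<Rightarrow>\<^sub>0 nat) \<Rightarrow>\<^sub>0 rat"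

definition mpoly_var :: "'v \<Rightarrow> 'v rat_mpoly" where
  "mpoly_var v = Poly_Mapping.single (Poly_Mapping.single v 1) 1"

definition mpoly_const :: "rat \<Rightarrow> 'v rat_mpoly" where
  "mpoly_const c = Poly_Mapping.single 0 c"

definition mpoly_ring :: "'v set \<Rightarrow> 'v rat_mpoly ring" where
  "mpoly_ring V = ring_of_type_algebra
     \<lparr>carrier := {p. \<forall>m \<in> Poly_Mapping.keys p. Poly_Mapping.keys m \<subseteq> V}\<rparr>"

definition homogeneous_mpolys :: "'v set \<Rightarrow> nat \<Rightarrow> 'v rat_mpoly set" where
  "homogeneous_mpolys V k = {p \<in> carrier (mpoly_ring V). \<forall>m \<in> Poly_Mapping.keys p.
     (\<Sum>v \<in> Poly_Mapping.keys m. Poly_Mapping.lookup m v) = k}"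


section \<open>The augmented Chow ring\<close>

datatype 'a chow_var = YVar 'a | XVar "'a set"

abbreviation proper_flats :: "'a set \<Rightarrow> 'a set set \<Rightarrow> 'a set set" where
  "proper_flats E M \<equiv> M - {E}"

text \<open>
  The tensor product of the polynomial rings in the \<open>y\<^sub>i\<close> and in the \<open>x\<^sub>F\<close> is realised as the
  polynomial ring in the disjoint union of the two sets of variables.
\<close>

definition chow_vars :: "'a set \<Rightarrow> 'a set set \<Rightarrow> 'a chow_var set" where
  "chow_vars E M = YVar ` E \<union> XVar ` proper_flats E M"

definition chow_poly_ring :: "'a set \<Rightarrow> 'a set set \<Rightarrow> 'a chow_var rat_mpoly ring" where
  "chow_poly_ring E M = mpoly_ring (chow_vars E M)"

definition chow_relations :: "'a set \<Rightarrow> 'a set set \<Rightarrow> 'a chow_var rat_mpoly set" where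
  "chow_relations E M =
     {mpoly_var (YVar i) - (\<Sum>F \<in> {F \<in> proper_flats E M. i \<notin> F}. mpoly_var (XVar F)) | i. i \<in> E} \<union>
     {mpoly_var (XVar F) * mpoly_var (XVar G) | F G.
        F \<in> proper_flats E M \<and> G \<in> proper_flats E M \<and> \<not> F \<subseteq> G \<and> \<not> G \<subseteq> F} \<union>
     {mpoly_var (YVar i) * mpoly_var (XVar F) | i F. i \<in> E \<and> F \<in> proper_flats E M \<and> i \<notin> F}"

definition chow_ideal :: "'a set \<Rightarrow> 'a set set \<Rightarrow> 'a chow_var rat_mpoly set" where
  "chow_ideal E M = genideal (chow_poly_ring E M) (chow_relations E M)"

definition chow_class ::
  "'a set \<Rightarrow> 'a set set \<Rightarrow> 'a chow_var rat_mpoly \<Rightarrow> 'a chow_var rat_mpoly set" where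
  "chow_class E M p = chow_ideal E M +>\<^bsub>chow_poly_ring E M\<^esub> p"

definition augmented_chow ::
  "'a set \<Rightarrow> 'a set set \<Rightarrow> (rat, 'a chow_var rat_mpoly set) module" where
  "augmented_chow E M =
     (let Q = chow_poly_ring E M Quot chow_ideal E M
      in \<lparr>carrier = carrier Q, monoid.mult = monoid.mult Q, one = one Q, ring.zero = ring.zero Q, add = add Q,
          module.smult = (\<lambda>c x. chow_class E M (mpoly_const c) \<otimes>\<^bsub>Q\<^esub> x)\<rparr>)"

definition augmented_chow_gr ::
  "'a set \<Rightarrow> 'a set set \<Rightarrow> nat \<Rightarrow> 'a chow_var rat_mpoly set set" where
  "augmented_chow_gr E M k = chow_class E M ` homogeneous_mpolys (chow_vars E M) k"

text \<open>The common value, over all bases \<open>I\<close> of \<open>F\<close>, of the product of the \<open>y\<^sub>i\<close> with \<open>i \<in> I\<close>.\<close>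

definition chow_y :: "'a set \<Rightarrow> 'a set set \<Rightarrow> 'a set \<Rightarrow> 'a chow_var rat_mpoly set" where
  "chow_y E M F = (THE y. \<exists>I. flat_basis E M F I \<and>
     y = finprod (augmented_chow E M) (\<lambda>i. chow_class E M (mpoly_var (YVar i))) I)"


section \<open>The graded Moebius algebra\<close>

text \<open>
  Elements are finitely supported rational combinations of flats; the basis symbol \<open>y\<^sub>F\<close> is
  \<open>Poly_Mapping.single F 1\<close>. The generic product on \<^typ>\<open>'a set \<Rightarrow>\<^sub>0 rat\<close> is not used. The unit is
  the symbol of the least flat, which is the empty set in the loopless case. The \<open>else\<close> branch
  in the product is the case where the ranks of \<open>F\<close> and \<open>G\<close> add up to more than the rank of
  the join, by submodularity of the rank.
\<close>

definition moebius_mult ::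
  "'a set set \<Rightarrow> ('a set \<Rightarrow>\<^sub>0 rat) \<Rightarrow> ('a set \<Rightarrow>\<^sub>0 rat) \<Rightarrow> ('a set \<Rightarrow>\<^sub>0 rat)" where
  "moebius_mult M f g =
     (\<Sum>F \<in> Poly_Mapping.keys f. \<Sum>G \<in> Poly_Mapping.keys g.
        if matroid_rank M F + matroid_rank M G = matroid_rank M (flat_join M F G)
        then Poly_Mapping.single (flat_join M F G)
               (Poly_Mapping.lookup f F * Poly_Mapping.lookup g G)
        else 0)"

definition graded_moebius :: "'a set set \<Rightarrow> (rat, 'a set \<Rightarrow>\<^sub>0 rat) module" where
  "graded_moebius M =
     \<lparr>carrier = {f. Poly_Mapping.keys f \<subseteq> M}, monoid.mult = moebius_mult M,
      one = Poly_Mapping.single (matroid_closure M {}) 1, ring.zero = 0, add = (+),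
      module.smult = (\<lambda>c. Poly_Mapping.map ((*) c))\<rparr>"

definition graded_moebius_gr :: "'a set set \<Rightarrow> nat \<Rightarrow> ('a set \<Rightarrow>\<^sub>0 rat) set" where
  "graded_moebius_gr M k = {f. Poly_Mapping.keys f \<subseteq> {F \<in> M. matroid_rank M F = k}}"

text \<open>The linear extension of \<open>y\<^sub>F \<mapsto> y\<^sub>F\<close>.\<close>

definition moebius_to_chow ::
  "'a set \<Rightarrow> 'a set set \<Rightarrow> ('a set \<Rightarrow>\<^sub>0 rat) \<Rightarrow> 'a chow_var rat_mpoly set" where
  "moebius_to_chow E M f = finsum (augmented_chow E M)
     (\<lambda>F. Poly_Mapping.lookup f F \<odot>\<^bsub>augmented_chow E M\<^esub> chow_y E M F) (Poly_Mapping.keys f)"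

end

theory Submission
  imports Defs "HOL-Library.Multiset"
begin

text \<open>
  Expanding \<open>y\<^sub>I y\<^sub>i\<close> by the linear relation leaves only the \<open>x\<^sub>F\<close> with \<open>I \<subseteq> F\<close> and \<open>i \<notin> F\<close>; hence
  \<open>y\<^sub>I y\<^sub>i = 0\<close> if \<open>i\<close> lies in the closure of \<open>I\<close>, and \<open>y\<^sub>I y\<^sub>i = y\<^sub>I y\<^sub>j\<close> if \<open>i\<close> and \<open>j\<close> span the same
  flat over \<open>I\<close>. This makes \<open>y\<^sub>F\<close> independent of the basis and multiplicative.

  For injectivity, let \<open>h\<^sub>F\<close> be the sum of the \<open>x\<^sub>G\<close> over proper \<open>G\<close> not containing \<open>F\<close>, so that \<open>y\<^sub>i = h\<^sub>i\<close>, and let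
  \<open>f\<close> be the functional on polynomials in the \<open>h\<^sub>F\<close> that sends a monomial \<open>m\<close> to 1 if Rado's condition
  \<open>|T| \<le> rk (\<Union>T)\<close> holds for all \<open>T \<subseteq> m\<close>, and to 0 otherwise. In the \<open>h\<^sub>F\<close> the quadratic relations become
  \<open>(h\<^sub>F - h\<^sub>J) (h\<^sub>G - h\<^sub>J) = 0\<close> for \<open>J = F \<or> G\<close>, and \<open>y\<^sub>i (h\<^sub>J - h\<^sub>F) = 0\<close> for \<open>J = F \<or> i\<close>; by submodularity
  \<open>f\<close> vanishes on the ideal they generate. Since \<open>f (y\<^sub>F) = 1\<close> and \<open>f (y\<^sub>F h\<^sub>G) = 0\<close> exactly if \<open>G \<subseteq> F\<close>,
  a relation \<open>\<Sum> a\<^sub>F y\<^sub>F = 0\<close> makes the sum of the \<open>a\<^sub>F\<close> over \<open>F \<supseteq> G\<close> vanish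
  for every flat \<open>G\<close>, so all \<open>a\<^sub>F\<close> are 0.
\<close>

section \<open>Rank and closure of a matroid given by flats\<close>

text \<open>A relation, so that its power \<open>covers M ^^ n\<close> expresses a saturated chain
  of flats with n steps; ranks are computed as such lengths.\<close>

definition covers :: "'a set set \<Rightarrow> ('a set \<times> 'a set) set" where
  "covers M = {(F, G). F \<in> M \<and> G \<in> M \<and> F \<subset> G \<and> \<not> (\<exists>H\<in>M. F \<subset> H \<and> H \<subset> G)}"

context matroid
begin

abbreviation cl :: "'a set \<Rightarrow> 'a set" where
  "cl \<equiv> matroid_closure M"

abbreviation rk :: "'a set \<Rightarrow> nat" where
  "rk S \<equiv> matroid_rank M (cl S)"

section \<open>Flats and closure\<close>

lemma finite_flats: "finite M"
  by (rule finite_subset[of _ "Pow E"]) (auto simp: finite_ground dest: flat_subset)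

lemma finite_flat: "F \<in> M \<Longrightarrow> finite F"
  using flat_subset finite_ground finite_subset by blast

text \<open>A maximal flat must be all of E: an element outside it would, by the covering axiom, lie
  in a strictly larger flat.\<close>

lemma ground_flat: "E \<in> M"
proof -
  obtain F where F: "F \<in> M" "\<And>G. G \<in> M \<Longrightarrow> F \<subseteq> G \<Longrightarrow> F = G"
    using finite_has_maximal[OF finite_flats flats_nonempty] by blast
  have "F = E"
  proof (rule ccontr)
    assume "F \<noteq> E"
    then obtain i where "i \<in> E - F" using flat_subset F(1) by blast
    from ex1_implies_ex[OF flat_cover[OF F(1) this]]
    obtain G where "G \<in> M" "F \<subset> G" by blast
    then show False using F(2) by blast
  qed
  then show ?thesis using F(1) by simp
qed

lemma Inter_flats:
  assumes "finite \<F>" "\<F> \<noteq> {}" "\<F> \<subseteq> M"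
  shows "\<Inter>\<F> \<in> M"
  using assms by (induction \<F> rule: finite_ne_induct) (auto intro: flat_Int)

lemma cl_flat:
  assumes "S \<subseteq> E"
  shows "cl S \<in> M"
  unfolding matroid_closure_def hull_def
  by (rule Inter_flats) (use assms ground_flat finite_flats in auto)

lemma subset_cl: "S \<subseteq> cl S"
  unfolding matroid_closure_def by (rule hull_subset)

lemma cl_mono: "S \<subseteq> T \<Longrightarrow> cl S \<subseteq> cl T"
  unfolding matroid_closure_def by (rule hull_mono)

lemma cl_minimal: "S \<subseteq> F \<Longrightarrow> F \<in> M \<Longrightarrow> cl S \<subseteq> F"
  unfolding matroid_closure_def by (rule hull_minimal)

lemma cl_of_flat: "F \<in> M \<Longrightarrow> cl F = F"
  unfolding matroid_closure_def by (rule hull_same)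

lemma cl_Un_left: "cl (cl S \<union> T) = cl (S \<union> T)"
  unfolding matroid_closure_def by (rule hull_Un_left[symmetric])

lemma cl_insert: "cl (insert i (cl S)) = cl (insert i S)"
  unfolding matroid_closure_def by (rule hull_insert[symmetric])

lemma cl_redundant: "i \<in> cl S \<Longrightarrow> cl (insert i S) = cl S"
  unfolding matroid_closure_def by (rule hull_redundant)

lemma cl_subset_ground: "S \<subseteq> E \<Longrightarrow> cl S \<subseteq> E"
  by (simp add: cl_flat flat_subset)

section \<open>The covering relation and equality of chain lengths\<close>

lemma coversD:
  assumes "(F, G) \<in> covers M"
  shows "F \<in> M" "G \<in> M" "F \<subset> G" "\<And>H. H \<in> M \<Longrightarrow> F \<subset> H \<Longrightarrow> H \<subset> G \<Longrightarrow> False"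
  using assms by (auto simp: covers_def)

text \<open>The flat G given by the covering axiom contains the closure of
  \<open>insert i F\<close>; that closure lies strictly above F, so minimality of G makes the two
  equal.\<close>

lemma cl_insert_covers:
  assumes F: "F \<in> M" and i: "i \<in> E - F"
  shows "(F, cl (insert i F)) \<in> covers M"
proof -
  obtain G where G: "G \<in> M" "F \<subset> G" "\<not> (\<exists>H\<in>M. F \<subset> H \<and> H \<subset> G)" "i \<in> G"
    using ex1_implies_ex[OF flat_cover[OF F i]] by blast
  have fl: "cl (insert i F) \<in> M"
    by (rule cl_flat) (use flat_subset[OF F] i in blast)
  have "cl (insert i F) \<subseteq> G"
    by (rule cl_minimal) (use G in auto)
  moreover have "F \<subset> cl (insert i F)"
    using subset_cl[of "insert i F"] i by blast
  ultimately have "cl (insert i F) = G"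
    using G(3) fl by blast
  then show ?thesis using G F by (auto simp: covers_def)
qed

lemma covers_eq_cl_insert:
  assumes FG: "(F, G) \<in> covers M" and i: "i \<in> G - F"
  shows "G = cl (insert i F)"
proof -
  have "(F, cl (insert i F)) \<in> covers M"
    using cl_insert_covers coversD[OF FG] flat_subset i by blast
  moreover have "cl (insert i F) \<subseteq> G"
    by (rule cl_minimal) (use coversD[OF FG] i in auto)
  ultimately show ?thesis
    using coversD[OF FG] coversD[of F "cl (insert i F)"] by blast
qed

lemma relpow_covers_subset: "(F, G) \<in> covers M ^^ n \<Longrightarrow> F \<subseteq> G"
proof (induction n arbitrary: G)
  case (Suc n)
  then obtain H where "(F, H) \<in> covers M ^^ n" "(H, G) \<in> covers M" by auto
  then show ?case using Suc.IH coversD(3) by blast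
qed simp

text \<open>Adding one missing element of G and closing gives a cover of F that is still below G and
  leaves fewer elements of G to reach.\<close>

lemma relpow_covers_exists:
  assumes "F \<in> M" "G \<in> M" "F \<subseteq> G"
  shows "\<exists>n. (F, G) \<in> covers M ^^ n"
  using assms
proof (induction "card (G - F)" arbitrary: F rule: less_induct)
  case less
  show ?case
  proof (cases "F = G")
    case True
    then show ?thesis by (intro exI[of _ 0]) simp
  next
    case False
    then obtain i where i: "i \<in> G - F" using less.prems by blast
    define H where "H = cl (insert i F)"
    have FH: "(F, H) \<in> covers M"
      unfolding H_def using cl_insert_covers i flat_subset less.prems by blast
    have "H \<subseteq> G" unfolding H_def by (rule cl_minimal) (use less.prems i in auto)
    moreover have "card (G - H) < card (G - F)"
      by (rule psubset_card_mono) (use finite_flat less.prems coversD(3)[OF FH] \<open>H \<subseteq> G\<close> in auto)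
    ultimately obtain n where "(H, G) \<in> covers M ^^ n"
      using less.hyps less.prems coversD(2)[OF FH] by blast
    then have "(F, G) \<in> covers M ^^ Suc n" using FH by (blast intro: relpow_Suc_I2)
    then show ?thesis by blast
  qed
qed

text \<open>
  Jordan--Dedekind: two flats covering a common flat are covered by their join,
  so the two chains can be compared through a chain starting at that join.
\<close>

lemma relpow_covers_length_unique:
  assumes "(F, G) \<in> covers M ^^ m" "(F, G) \<in> covers M ^^ n"
  shows "m = n"
  using assms
proof (induction m arbitrary: F n)
  case 0
  show ?case
  proof (cases n)
    case (Suc k)
    then obtain H where "(F, H) \<in> covers M" "(H, G) \<in> covers M ^^ k"
      using 0 relpow_Suc_D2 by metis
    moreover have "F = G" using 0 by simp
    ultimately show ?thesis using relpow_covers_subset[of H G k] coversD(3)[of F H] by blast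
  qed simp
next
  case (Suc m)
  obtain A where A: "(F, A) \<in> covers M" "(A, G) \<in> covers M ^^ m"
    using Suc.prems(1) relpow_Suc_D2 by metis
  obtain k where n: "n = Suc k"
    using Suc.prems(2) A coversD(3)[OF A(1)] relpow_covers_subset[OF A(2)] by (cases n) auto
  obtain B where B: "(F, B) \<in> covers M" "(B, G) \<in> covers M ^^ k"
    using Suc.prems(2) relpow_Suc_D2 unfolding n by metis
  have "m = k"
  proof (cases "A = B")
    case True
    then show ?thesis using Suc.IH A B by blast
  next
    case False
    have nsub: "\<not> A \<subseteq> B" "\<not> B \<subseteq> A"
      using False coversD[OF A(1)] coversD[OF B(1)] by blast+
    obtain a where a: "a \<in> A - F" using coversD(3)[OF A(1)] by blast
    obtain b where b: "b \<in> B - F" using coversD(3)[OF B(1)] by blast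
    have Aa: "A = cl (insert a F)" and Bb: "B = cl (insert b F)"
      using covers_eq_cl_insert A(1) B(1) a b by blast+
    define Z where "Z = cl (insert a (insert b F))"
    have ZA: "Z = cl (insert b A)" and ZB: "Z = cl (insert a B)"
      unfolding Z_def Aa Bb cl_insert by (simp_all add: insert_commute)
    have AE: "A \<subseteq> E" "B \<subseteq> E" using coversD(2) A(1) B(1) flat_subset by blast+
    have "b \<notin> A" "a \<notin> B"
      using nsub Aa Bb cl_minimal[of "insert b F" A] cl_minimal[of "insert a F" B]
        coversD[OF A(1)] coversD[OF B(1)] by auto
    then have AZ: "(A, Z) \<in> covers M" and BZ: "(B, Z) \<in> covers M"
      using cl_insert_covers[of A b] cl_insert_covers[of B a] coversD(2)[OF A(1)] coversD(2)[OF B(1)]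
        a b AE ZA ZB by auto
    have G: "G \<in> M"
      using A(2) coversD(2)[OF A(1)] coversD(2) by (cases m) auto
    have "Z \<subseteq> G" unfolding ZA
      by (rule cl_minimal) (use G b relpow_covers_subset A(2) B(2) in auto)
    then obtain l where l: "(Z, G) \<in> covers M ^^ l"
      using relpow_covers_exists coversD(2)[OF AZ] G by blast
    \<comment> \<open>The induction hypothesis speaks only of chains of length m. It is used first
      at A, which gives m = Suc l; only then does the chain from B through Z have length m, so that
      it can be compared with the one of length k.\<close>
    have "m = Suc l" using Suc.IH A(2) AZ l relpow_Suc_I2 by metis
    moreover have "(B, G) \<in> covers M ^^ Suc l" using BZ l relpow_Suc_I2 by metis
    ultimately show ?thesis using Suc.IH B(2) by blast
  qed
  then show ?case using n by simp
qed

section \<open>Rank as the length of saturated chains\<close>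

lemma cl_empty_subset: "F \<in> M \<Longrightarrow> cl {} \<subseteq> F"
  by (rule cl_minimal) auto

text \<open>The largest member G of C is covered by F, and removing it leaves a maximal chain below
  G, since a larger one would stay a chain after putting G back. As F is not in C, there are exactly
  \<open>card C\<close> steps from the least flat to F.\<close>

lemma maxchain_relpow_covers:
  assumes "F \<in> M" "subset.maxchain {G \<in> M. G \<subset> F} C"
  shows "(cl {}, F) \<in> covers M ^^ card C"
  using assms
proof (induction "card F" arbitrary: F C rule: less_induct)
  case less
  have chain: "C \<subseteq> {G \<in> M. G \<subset> F}" "\<And>U V. U \<in> C \<Longrightarrow> V \<in> C \<Longrightarrow> U \<subseteq> V \<or> V \<subseteq> U"
    using less.prems(2) unfolding subset.maxchain_def subset_chain_def by blast+
  have max: "D = C" if "D \<subseteq> {G \<in> M. G \<subset> F}" "C \<subseteq> D"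
    "\<And>U V. U \<in> D \<Longrightarrow> V \<in> D \<Longrightarrow> U \<subseteq> V \<or> V \<subseteq> U" for D
  proof -
    have "subset.chain {G \<in> M. G \<subset> F} D"
      unfolding subset_chain_def using that by blast
    then have "\<not> C \<subset> D"
      using less.prems(2) unfolding subset.maxchain_def by blast
    then show ?thesis using that(2) by blast
  qed
  have finC: "finite C" using chain(1) finite_flats finite_subset[of C M] by blast
  show ?case
  proof (cases "C = {}")
    case True
    have "F = cl {}"
    proof (rule ccontr)
      assume "F \<noteq> cl {}"
      \<comment> \<open>If F were not the least flat, the least flat alone would be a chain
        extending the empty one.\<close>
      then have "{cl {}} = C"
        by (intro max) (use cl_empty_subset[OF less.prems(1)] cl_flat True in auto)
      then show False using True by simp
    qed
    then show ?thesis using True by simp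
  next
    case False
    obtain G where G: "G \<in> C" "\<forall>H\<in>C. G \<subseteq> H \<longrightarrow> G = H"
      using finite_has_maximal[OF finC False] by blast
    then have G_max: "H \<subseteq> G" if "H \<in> C" for H
      using chain(2)[OF that G(1)] that by blast
    have GF: "G \<in> M" "G \<subset> F" using G chain(1) by blast+
    have "(G, F) \<in> covers M"
    proof (rule ccontr)
      assume "(G, F) \<notin> covers M"
      then obtain H where H: "H \<in> M" "G \<subset> H" "H \<subset> F"
        using GF less.prems(1) by (auto simp: covers_def)
      have "insert H C = C"
      proof (rule max)
        show "insert H C \<subseteq> {G \<in> M. G \<subset> F}" using chain(1) H by blast
        show "U \<subseteq> V \<or> V \<subseteq> U" if "U \<in> insert H C" "V \<in> insert H C" for U V
          using that chain(2) G_max H(2) by blast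
      qed blast
      then show False using H(2) G_max by blast
    qed
    moreover have "subset.maxchain {H \<in> M. H \<subset> G} (C - {G})"
      unfolding subset.maxchain_def subset_chain_def
    proof (intro conjI notI)
      show "C - {G} \<subseteq> {H \<in> M. H \<subset> G}" using chain(1) G_max by blast
      show "\<forall>U\<in>C - {G}. \<forall>V\<in>C - {G}. U \<subseteq> V \<or> V \<subseteq> U" using chain(2) by blast
      assume "\<exists>D. (D \<subseteq> {H \<in> M. H \<subset> G} \<and> (\<forall>U\<in>D. \<forall>V\<in>D. U \<subseteq> V \<or> V \<subseteq> U)) \<and> C - {G} \<subset> D"
      then obtain D where D: "D \<subseteq> {H \<in> M. H \<subset> G}" "\<forall>U\<in>D. \<forall>V\<in>D. U \<subseteq> V \<or> V \<subseteq> U"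
        "C - {G} \<subset> D" by blast
      have "insert G D = C"
      proof (rule max)
        show "insert G D \<subseteq> {G \<in> M. G \<subset> F}" using D GF by blast
        show "C \<subseteq> insert G D" using D by blast
        show "U \<subseteq> V \<or> V \<subseteq> U" if "U \<in> insert G D" "V \<in> insert G D" for U V
          using that D by blast
      qed
      then show False using D by blast
    qed
    moreover have "card G < card F"
      by (rule psubset_card_mono) (use GF finite_flat less.prems in auto)
    ultimately have "(cl {}, F) \<in> covers M ^^ Suc (card (C - {G}))"
      using less.hyps GF(1) by auto
    then show ?thesis using card.remove[OF finC G(1)] by simp
  qed
qed

text \<open>All maximal chains have n members because chain lengths are unique. The definite
  description also needs some maximal chain to exist, which is Hausdorff's principle.\<close>

lemma matroid_rank_eq:
  assumes "(cl {}, F) \<in> covers M ^^ n" "F \<in> M"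
  shows "matroid_rank M F = n"
  unfolding matroid_rank_def
proof (rule the_equality)
  show "\<forall>C. subset.maxchain {G \<in> M. G \<subset> F} C \<longrightarrow> card C = n"
    using maxchain_relpow_covers[OF assms(2)] relpow_covers_length_unique assms(1) by blast
  then show "k = n" if "\<forall>C. subset.maxchain {G \<in> M. G \<subset> F} C \<longrightarrow> card C = k" for k
    using that subset.Hausdorff by metis
qed

section \<open>The rank function on subsets of the ground set\<close>

lemma rk_empty [simp]: "rk {} = 0"
  by (rule matroid_rank_eq) (auto simp: cl_flat)

text \<open>Adding an element outside the closure is one covering step, so it lengthens the chain
  from the least flat by exactly one.\<close>

lemma rk_insert:
  assumes "S \<subseteq> E" "i \<in> E"
  shows "rk (insert i S) = (if i \<in> cl S then rk S else Suc (rk S))"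
proof (cases "i \<in> cl S")
  case True
  then show ?thesis by (simp add: cl_redundant)
next
  case False
  have S: "cl S \<in> M" using assms cl_flat by blast
  then obtain n where n: "(cl {}, cl S) \<in> covers M ^^ n"
    using relpow_covers_exists[OF _ S] cl_flat cl_empty_subset[OF S] by blast
  have "(cl S, cl (insert i S)) \<in> covers M"
    using cl_insert_covers[OF S, of i] assms False by (auto simp: cl_insert)
  then have "(cl {}, cl (insert i S)) \<in> covers M ^^ Suc n" "cl (insert i S) \<in> M"
    using n coversD(2) by auto
  then show ?thesis using False matroid_rank_eq[OF n S] matroid_rank_eq by simp
qed

lemma rk_insert_le: "S \<subseteq> E \<Longrightarrow> i \<in> E \<Longrightarrow> rk (insert i S) \<le> Suc (rk S)"
  by (simp add: rk_insert)

lemma rk_cl_Un [simp]: "rk (cl S \<union> T) = rk (S \<union> T)"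
  by (simp add: cl_Un_left)

lemma rk_mono:
  assumes "S \<subseteq> T" "T \<subseteq> E"
  shows "rk S \<le> rk T"
proof -
  have "rk S \<le> rk (S \<union> D)" if "D \<subseteq> E" "finite D" for D
    using that(2,1)
  proof (induction D)
    case (insert d D)
    have "d \<in> E" "S \<union> D \<subseteq> E" using insert.prems assms by auto
    then show ?case using rk_insert[of "S \<union> D" d] insert by (simp split: if_splits)
  qed simp
  from this[of T] show ?thesis using assms finite_ground finite_subset by (auto simp: Un_absorb1)
qed

lemma rk_le_card:
  assumes "S \<subseteq> E"
  shows "rk S \<le> card S"
proof -
  have "finite S" using assms finite_ground finite_subset by blast
  then show ?thesis using assms
  proof (induction S)
    case (insert i S)
    then show ?case using rk_insert_le[of S i] by auto
  qed simp
qed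

text \<open>Adding the elements of D one by one: an element outside the closure of the larger set
  \<open>T \<union> D\<close> is also outside that of \<open>S \<union> D\<close>, so the left side
  never grows faster than the right.\<close>

lemma rk_Un_increment:
  assumes "S \<subseteq> T" "T \<subseteq> E" "D \<subseteq> E"
  shows "rk (T \<union> D) + rk S \<le> rk T + rk (S \<union> D)"
proof -
  have "finite D" using assms finite_ground finite_subset by blast
  then show ?thesis using assms(3)
  proof (induction D)
    case (insert d D)
    have dD: "d \<in> E" "S \<union> D \<subseteq> E" "T \<union> D \<subseteq> E" using insert.prems assms by auto
    have "cl (S \<union> D) \<subseteq> cl (T \<union> D)" by (rule cl_mono) (use assms in blast)
    moreover have "rk (T \<union> D) + rk S \<le> rk T + rk (S \<union> D)" using insert by simp
    moreover note rk_insert[OF dD(2,1)] rk_insert[OF dD(3,1)]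
    ultimately show ?case by (auto split: if_splits)
  qed simp
qed

text \<open>The increment bound at D = B. S is any common subset, not only the intersection, which
  suits unions taken over a multiset intersection.\<close>

lemma rk_submodular:
  assumes "S \<subseteq> A" "S \<subseteq> B" "A \<subseteq> E" "B \<subseteq> E"
  shows "rk (A \<union> B) + rk S \<le> rk A + rk B"
  using rk_Un_increment[of S A B] assms by (simp add: Un_absorb1)

section \<open>Independent sets and bases\<close>

lemma indep_iff: "matroid_indep E M I \<longleftrightarrow> I \<subseteq> E \<and> rk I = card I"
  by (simp add: matroid_indep_def)

lemma indep_finite: "matroid_indep E M I \<Longrightarrow> finite I"
  unfolding indep_iff using finite_ground finite_subset by blast

text \<open>Subadditivity bounds the rank of I by the ranks of J and \<open>I - J\<close>, each at
  most its cardinality; these cardinalities add up to \<open>card I\<close>, so equality holds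
  throughout.\<close>

lemma indep_subset:
  assumes "matroid_indep E M I" "J \<subseteq> I"
  shows "matroid_indep E M J"
proof -
  have I: "I \<subseteq> E" "rk I = card I" using assms by (auto simp: indep_iff)
  have "J \<union> (I - J) = I" "J \<subseteq> E" "I - J \<subseteq> E" using I assms by auto
  then have "rk I + rk {} \<le> rk J + rk (I - J)"
    using rk_submodular[of "{}" J "I - J"] by simp
  moreover have "rk (I - J) \<le> card (I - J)" "rk J \<le> card J"
    using rk_le_card I assms by blast+
  moreover have "card I = card J + card (I - J)"
    using assms indep_finite[OF assms(1)] by (metis card_Diff_subset card_mono finite_subset le_add_diff_inverse)
  ultimately show ?thesis using I assms by (auto simp: indep_iff)
qed

lemma indep_insert:
  assumes "matroid_indep E M I" "i \<in> E - cl I"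
  shows "matroid_indep E M (insert i I)"
  using assms rk_insert[of I i] indep_finite[OF assms(1)] subset_cl[of I]
  by (auto simp: indep_iff card_insert_if)

lemma indep_not_in_cl_remove:
  assumes "matroid_indep E M I" "i \<in> I"
  shows "i \<notin> cl (I - {i})"
proof
  assume "i \<in> cl (I - {i})"
  then have "cl I = cl (I - {i})" using cl_redundant assms(2) by (metis insert_Diff)
  then have "card I \<le> card (I - {i})"
    using assms rk_le_card[of "I - {i}"] by (auto simp: indep_iff)
  then show False using assms indep_finite
    by (metis card_Diff1_less not_le)
qed

text \<open>A maximal independent subset of F spans F, since an element of F outside its closure
  could be added.\<close>

lemma basis_exists:
  assumes "F \<in> M"
  shows "\<exists>I\<subseteq>F. flat_basis E M F I"
proof -
  let ?P = "{I. I \<subseteq> F \<and> matroid_indep E M I}"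
  have fin: "finite ?P" using finite_flat[OF assms] by auto
  have "{} \<in> ?P" by (auto simp: indep_iff)
  then have "?P \<noteq> {}" by blast
  from finite_has_maximal[OF fin this]
  obtain I where I: "I \<in> ?P" "\<forall>J\<in>?P. I \<subseteq> J \<longrightarrow> I = J" by (elim bexE)
  have "F \<subseteq> cl I"
  proof (rule ccontr)
    assume "\<not> F \<subseteq> cl I"
    then obtain i where i: "i \<in> F" "i \<notin> cl I" by blast
    have "insert i I \<in> ?P"
      using I(1) i flat_subset[OF assms] indep_insert by blast
    then have "I = insert i I" using I(2) by blast
    then show False using i(2) subset_cl by blast
  qed
  moreover have "cl I \<subseteq> F" using cl_minimal I(1) assms by blast
  ultimately show ?thesis using I(1) by (auto simp: flat_basis_def)
qed

lemma flat_basisD: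
  assumes "flat_basis E M F I"
  shows "matroid_indep E M I" "cl I = F" "I \<subseteq> F" "I \<subseteq> E" "F \<in> M" "card I = matroid_rank M F" "finite I"
proof -
  show I: "matroid_indep E M I" "cl I = F" using assms by (auto simp: flat_basis_def)
  show "I \<subseteq> F" using subset_cl[of I] I(2) by simp
  show IE: "I \<subseteq> E" and "card I = matroid_rank M F" using I by (auto simp: indep_iff)
  show "F \<in> M" using cl_flat[OF IE] I(2) by simp
  show "finite I" using indep_finite I(1) .
qed

text \<open>An element i of \<open>I - J\<close> is replaced by some j in J outside the closure of
  \<open>I - {i}\<close>, and \<open>I - J\<close> shrinks. The step speaks of closures over A, the
  form in which products y_A y_i and y_A y_j are compared.\<close>

lemma basis_exchange_induct [consumes 2, case_names refl step]:
  assumes "flat_basis E M F I" "flat_basis E M F J"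
    and refl: "\<And>I. flat_basis E M F I \<Longrightarrow> P I I"
    and step: "\<And>A i j J. i \<in> E - A \<Longrightarrow> j \<in> E - A \<Longrightarrow> A \<subseteq> E \<Longrightarrow> cl (insert i A) = cl (insert j A) \<Longrightarrow>
      P (insert j A) J \<Longrightarrow> P (insert i A) J"
  shows "P I J"
  using assms(1,2)
proof (induction "card (I - J)" arbitrary: I rule: less_induct)
  case less
  note I = flat_basisD[OF less.prems(1)] and J = flat_basisD[OF less.prems(2)]
  show ?case
  proof (cases "I \<subseteq> J")
    case True
    then have "I = J" using card_subset_eq[OF J(7)] I(6) J(6) by simp
    then show ?thesis using refl less.prems by blast
  next
    case False
    then obtain i where i: "i \<in> I" "i \<notin> J" by blast
    define A where "A = I - {i}"
    have iA: "i \<notin> cl A" unfolding A_def using indep_not_in_cl_remove I(1) i(1) by blast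
    have AE: "A \<subseteq> E" "A \<subseteq> I" and IA: "I = insert i A" using I A_def i by auto
    have "\<not> J \<subseteq> cl A"
    proof
      assume "J \<subseteq> cl A"
      then have "F \<subseteq> cl A" using cl_minimal[of J "cl A"] cl_flat[OF AE(1)] J by simp
      then show False using iA i(1) I(3) by blast
    qed
    then obtain j where j: "j \<in> J" "j \<notin> cl A" by blast
    have A: "matroid_indep E M A" using indep_subset I(1) AE by blast
    have jE: "j \<in> E" using j J by blast
    have "cl A \<in> M" using cl_flat AE(1) by blast
    \<comment> \<open>Since F covers \<open>cl A\<close>, the element j of F outside
      \<open>cl A\<close> spans F over A just as i does.\<close>
    moreover have "(cl A, F) \<in> covers M"
      using cl_insert_covers[OF \<open>cl A \<in> M\<close>, of i] iA I i unfolding cl_insert IA by auto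
    ultimately have clj: "cl (insert j A) = F"
      using covers_eq_cl_insert[of "cl A" F j] j J by (auto simp: cl_insert)
    have "flat_basis E M F (insert j A)"
      using clj indep_insert[OF A] j jE by (simp add: flat_basis_def)
    moreover have "card (insert j A - J) < card (I - J)"
      by (rule psubset_card_mono) (use i j I A_def in auto)
    ultimately have "P (insert j A) J" using less by blast
    then show ?thesis
      unfolding IA
    proof (rule step[rotated -1])
      show "i \<in> E - A" using i(1) I(4) A_def by blast
      show "j \<in> E - A" using jE j(2) subset_cl[of A] by blast
      show "A \<subseteq> E" by (rule AE)
      show "cl (insert i A) = cl (insert j A)" using I(2) IA clj by simp
    qed
  qed
qed

end

section \<open>Linear extension and evaluation of polynomial mappings\<close>

lemma poly_mapping_sum_single:
  fixes p :: "'k \<Rightarrow>\<^sub>0 'b::comm_monoid_add"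
  shows "p = (\<Sum>k\<in>Poly_Mapping.keys p. Poly_Mapping.single k (Poly_Mapping.lookup p k))"
  by (rule poly_mapping_eqI)
    (auto simp: lookup_sum lookup_single when_def sum.delta' in_keys_iff)

lemma poly_mapping_induct_add [case_names single add]:
  fixes p :: "'k \<Rightarrow>\<^sub>0 'b::comm_monoid_add"
  assumes single: "\<And>k v. P (Poly_Mapping.single k v)"
    and add: "\<And>p q. P p \<Longrightarrow> P q \<Longrightarrow> P (p + q)"
  shows "P p"
proof -
  have "P (\<Sum>k\<in>A. Poly_Mapping.single k (Poly_Mapping.lookup p k))" if "finite A" for A
    using that
  proof (induction A)
    case empty
    \<comment> \<open>The zero mapping is a single term with coefficient 0 at an arbitrary
      key.\<close>
    show ?case using single[of undefined 0] by simp
  qed (simp add: single add)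
  from this[of "Poly_Mapping.keys p"] show ?thesis
    by (simp flip: poly_mapping_sum_single)
qed

text \<open>Serves two coefficient maps: the identity of the rationals, for linear functionals, and
  the embedding of the rationals as constants, for evaluation into polynomial rings.\<close>

locale coefficient_hom =
  fixes c :: "rat \<Rightarrow> 'b::comm_ring_1"
  assumes hom_add: "c (x + y) = c x + c y"
    and hom_mult: "c (x * y) = c x * c y"
    and hom_one: "c 1 = 1"
begin

lemma hom_zero: "c 0 = 0"
  using hom_add[of 0 0] by simp

definition lin_ext :: "('k \<Rightarrow> 'b) \<Rightarrow> ('k \<Rightarrow>\<^sub>0 rat) \<Rightarrow> 'b" where
  "lin_ext g p = (\<Sum>k\<in>Poly_Mapping.keys p. c (Poly_Mapping.lookup p k) * g k)"

lemma lin_ext_superset: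
  assumes "finite A" "Poly_Mapping.keys p \<subseteq> A"
  shows "lin_ext g p = (\<Sum>k\<in>A. c (Poly_Mapping.lookup p k) * g k)"
  unfolding lin_ext_def
  by (rule sum.mono_neutral_left) (use assms in \<open>auto simp: in_keys_iff hom_zero\<close>)

lemma lin_ext_zero [simp]: "lin_ext g 0 = 0"
  by (simp add: lin_ext_def)

lemma lin_ext_add: "lin_ext g (p + q) = lin_ext g p + lin_ext g q"
proof -
  let ?A = "Poly_Mapping.keys p \<union> Poly_Mapping.keys q"
  have "lin_ext g (p + q) = (\<Sum>k\<in>?A. c (Poly_Mapping.lookup (p + q) k) * g k)"
    by (rule lin_ext_superset) (auto dest: set_mp[OF keys_add])
  then show ?thesis
    by (simp add: lin_ext_superset[of ?A] lookup_add hom_add distrib_right sum.distrib)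
qed

lemma lin_ext_diff: "lin_ext g (p - q) = lin_ext g p - lin_ext g q"
  using lin_ext_add[of g "p - q" q] by simp

lemma lin_ext_sum: "lin_ext g (\<Sum>i\<in>A. p i) = (\<Sum>i\<in>A. lin_ext g (p i))"
  by (induction A rule: infinite_finite_induct) (simp_all add: lin_ext_add)

lemma lin_ext_single [simp]: "lin_ext g (Poly_Mapping.single k x) = c x * g k"
  by (cases "x = 0") (simp_all add: lin_ext_def hom_zero)

lemma lin_ext_mult:
  fixes g :: "'k::comm_monoid_add \<Rightarrow> 'b"
  assumes "\<And>a b. g (a + b) = g a * g b"
  shows "lin_ext g (p * q) = lin_ext g p * lin_ext g q"
proof (induction p rule: poly_mapping_induct_add)
  case (single k x)
  show ?case
  proof (induction q rule: poly_mapping_induct_add)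
    case (single l y)
    show ?case by (simp add: mult_single hom_mult assms mult_ac)
  qed (simp add: distrib_left lin_ext_add)
qed (simp add: distrib_right lin_ext_add)

end

interpretation rat: coefficient_hom "\<lambda>x. x"
  by unfold_locales simp_all

interpretation const: coefficient_hom "Poly_Mapping.single 0 :: rat \<Rightarrow> 'k::comm_monoid_add \<Rightarrow>\<^sub>0 rat"
  by unfold_locales (simp_all add: single_add mult_single)

definition monom_eval :: "('v \<Rightarrow> 'b::comm_ring_1) \<Rightarrow> ('v \<Rightarrow>\<^sub>0 nat) \<Rightarrow> 'b" where
  "monom_eval \<phi> m = (\<Prod>v\<in>Poly_Mapping.keys m. \<phi> v ^ Poly_Mapping.lookup m v)"

lemma monom_eval_add: "monom_eval \<phi> (m + n) = monom_eval \<phi> m * monom_eval \<phi> n"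
proof -
  let ?A = "Poly_Mapping.keys m \<union> Poly_Mapping.keys n"
  have *: "monom_eval \<phi> l = (\<Prod>v\<in>?A. \<phi> v ^ Poly_Mapping.lookup l v)" if "Poly_Mapping.keys l \<subseteq> ?A" for l
    unfolding monom_eval_def by (rule prod.mono_neutral_left) (use that in \<open>auto simp: in_keys_iff\<close>)
  show ?thesis
    by (subst (1 2 3) *) (auto simp: lookup_add power_add prod.distrib dest: set_mp[OF keys_add])
qed

definition mpoly_eval :: "('v \<Rightarrow> ('k::comm_monoid_add \<Rightarrow>\<^sub>0 rat)) \<Rightarrow> 'v rat_mpoly \<Rightarrow> ('k \<Rightarrow>\<^sub>0 rat)" where
  "mpoly_eval \<phi> = const.lin_ext (monom_eval \<phi>)"

lemma mpoly_eval_zero [simp]: "mpoly_eval \<phi> 0 = 0"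
  by (simp add: mpoly_eval_def)

lemma mpoly_eval_add: "mpoly_eval \<phi> (p + q) = mpoly_eval \<phi> p + mpoly_eval \<phi> q"
  by (simp add: mpoly_eval_def const.lin_ext_add)

lemma mpoly_eval_diff: "mpoly_eval \<phi> (p - q) = mpoly_eval \<phi> p - mpoly_eval \<phi> q"
  by (simp add: mpoly_eval_def const.lin_ext_diff)

lemma mpoly_eval_sum: "mpoly_eval \<phi> (\<Sum>i\<in>A. p i) = (\<Sum>i\<in>A. mpoly_eval \<phi> (p i))"
  by (simp add: mpoly_eval_def const.lin_ext_sum)

lemma mpoly_eval_mult: "mpoly_eval \<phi> (p * q) = mpoly_eval \<phi> p * mpoly_eval \<phi> q"
  by (simp add: mpoly_eval_def const.lin_ext_mult monom_eval_add)

lemma mpoly_eval_var [simp]: "mpoly_eval \<phi> (mpoly_var v) = \<phi> v"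
  by (simp add: mpoly_eval_def mpoly_var_def monom_eval_def)

lemma mpoly_eval_const [simp]: "mpoly_eval \<phi> (mpoly_const x) = Poly_Mapping.single 0 x"
  by (simp add: mpoly_eval_def mpoly_const_def monom_eval_def)

lemma mpoly_eval_one [simp]: "mpoly_eval \<phi> 1 = 1"
  using mpoly_eval_const[of \<phi> 1] by (simp add: mpoly_const_def)


section \<open>The Rado functional\<close>

lemma subset_add_mset_iff:
  "T \<subseteq># add_mset S m \<longleftrightarrow> T \<subseteq># m \<or> (\<exists>T'. T = add_mset S T' \<and> T' \<subseteq># m)"
proof
  assume T: "T \<subseteq># add_mset S m"
  show "T \<subseteq># m \<or> (\<exists>T'. T = add_mset S T' \<and> T' \<subseteq># m)"
  proof (cases "S \<in># T")
    case True
    then obtain T' where "T = add_mset S T'" by (metis mset_add)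
    then show ?thesis using T by simp
  next
    case False
    have "T \<subseteq># m" unfolding subseteq_mset_def
    proof
      fix a show "count T a \<le> count m a"
        using mset_subset_eq_count[OF T, of a] False by (cases "a = S") (auto simp: not_in_iff)
    qed
    then show ?thesis by blast
  qed
next
  assume "T \<subseteq># m \<or> (\<exists>T'. T = add_mset S T' \<and> T' \<subseteq># m)"
  then show "T \<subseteq># add_mset S m"
    by (auto intro: subset_mset.order_trans simp: subset_mset.add_increasing)
qed

context matroid
begin

text \<open>
  \<open>slack j m S\<close> says that \<open>S\<close> has rank at least \<open>j\<close> in the matroid obtained
  from the given one by principal truncations along the members of \<open>m\<close>.
\<close>

definition slack :: "nat \<Rightarrow> 'a set multiset \<Rightarrow> 'a set \<Rightarrow> bool" where
  "slack j m S \<longleftrightarrow> (\<forall>T. T \<subseteq># m \<longrightarrow> size T + j \<le> rk (S \<union> \<Union>(set_mset T)))"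

definition rado :: "'a set multiset \<Rightarrow> bool" where
  "rado m \<longleftrightarrow> (\<forall>S\<in>#m. S \<subseteq> E) \<and> slack 0 m {}"

text \<open>A submultiset of \<open>add_mset G m\<close> lies in m or is one of m with G added; in
  the second case G joins the set and the size grows by one. This recursion drives all later
  computations with \<open>slack\<close>.\<close>

lemma slack_add_mset: "slack j (add_mset G m) F \<longleftrightarrow> slack j m F \<and> slack (Suc j) m (F \<union> G)"
  unfolding slack_def subset_add_mset_iff by (auto simp: Un_assoc)

lemma rado_add_mset: "S \<subseteq> E \<Longrightarrow> rado (add_mset S m) \<longleftrightarrow> rado m \<and> slack 1 m S"
  by (auto simp: rado_def slack_add_mset)

lemma rado_add_mset2:
  assumes "F \<subseteq> E" "G \<subseteq> E"
  shows "rado (add_mset F (add_mset G m)) \<longleftrightarrow>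
    rado m \<and> slack 1 m F \<and> slack 1 m G \<and> slack 2 m (F \<union> G)"
  using assms by (auto simp: rado_add_mset slack_add_mset numeral_2_eq_2)

lemma slack_cl [simp]: "slack j m (cl S) \<longleftrightarrow> slack j m S"
  by (simp add: slack_def)

lemma slack_mono: "slack j m S \<Longrightarrow> i \<le> j \<Longrightarrow> slack i m S"
  unfolding slack_def by (meson add_left_mono order_trans)

lemma rado_Union_subset: "rado m \<Longrightarrow> T \<subseteq># m \<Longrightarrow> \<Union>(set_mset T) \<subseteq> E"
  unfolding rado_def by (auto dest: mset_subset_eqD)

text \<open>Uncrossing: let T violate the condition for F and U that for G. Submodularity bounds the
  ranks belonging to the multiset union and intersection of T and U by
  \<open>size T + size U\<close>, while the hypotheses make them at least one more.\<close>

lemma slack_Un: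
  assumes m: "rado m" and FG: "F \<subseteq> E" "G \<subseteq> E" and slack: "slack 1 m (F \<union> G)"
  shows "slack 1 m F \<or> slack 1 m G"
proof (rule ccontr)
  assume "\<not> ?thesis"
  then obtain T U where T: "T \<subseteq># m" "rk (F \<union> \<Union>(set_mset T)) \<le> size T"
    and U: "U \<subseteq># m" "rk (G \<union> \<Union>(set_mset U)) \<le> size U"
    by (auto simp: slack_def not_le less_Suc_eq_le)
  let ?u = "\<lambda>T. \<Union>(set_mset T)"
  have TU: "T \<union># U \<subseteq># m" "T \<inter># U \<subseteq># m"
    using T(1) U(1) by (auto intro: subset_mset.le_infI1)
  have sub: "?u T \<subseteq> E" "?u U \<subseteq> E"
    using rado_Union_subset m T(1) U(1) by blast+
  have "(F \<union> ?u T) \<union> (G \<union> ?u U) = (F \<union> G) \<union> ?u (T \<union># U)"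
    by auto
  \<comment> \<open>The union over \<open>T \<inter># U\<close> lies in both sets but may be smaller
    than their intersection, hence the use of an arbitrary common subset.\<close>
  then have "rk ((F \<union> G) \<union> ?u (T \<union># U)) + rk (?u (T \<inter># U)) \<le> rk (F \<union> ?u T) + rk (G \<union> ?u U)"
    using rk_submodular[of "?u (T \<inter># U)" "F \<union> ?u T" "G \<union> ?u U"] FG sub by auto
  moreover have "size (T \<union># U) + 1 \<le> rk ((F \<union> G) \<union> ?u (T \<union># U))"
    using slack TU(1) unfolding slack_def by blast
  moreover have "size (T \<inter># U) \<le> rk (?u (T \<inter># U))"
    using m TU(2) unfolding rado_def slack_def by (metis Un_empty_left add_0_right)
  moreover note size_Un_Int[of T U]
  ultimately show False using T(2) U(2) by linarith
qed

text \<open>Monomials are multisets of sets, with addition of multisets as their product, so the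
  generic product of \<open>Poly_Mapping\<close> is that of polynomials. Indices are arbitrary sets,
  which makes \<open>h {i}\<close> available.\<close>

abbreviation h :: "'a set \<Rightarrow> ('a set multiset \<Rightarrow>\<^sub>0 rat)" where
  "h S \<equiv> Poly_Mapping.single {#S#} 1"

definition rado_sum :: "('a set multiset \<Rightarrow>\<^sub>0 rat) \<Rightarrow> rat" where
  "rado_sum = rat.lin_ext (\<lambda>m. of_bool (rado m))"

text \<open>The largest ideal on which \<open>rado_sum\<close> vanishes; an ideal is contained in it
  as soon as its generators are.\<close>

definition rado_kernel :: "('a set multiset \<Rightarrow>\<^sub>0 rat) set" where
  "rado_kernel = {p. \<forall>q. rado_sum (p * q) = 0}"

lemma rado_sum_single [simp]: "rado_sum (Poly_Mapping.single m x) = x * of_bool (rado m)"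
  by (simp add: rado_sum_def)

lemma rado_sum_add: "rado_sum (p + q) = rado_sum p + rado_sum q"
  and rado_sum_diff: "rado_sum (p - q) = rado_sum p - rado_sum q"
  and rado_sum_sum: "rado_sum (\<Sum>i\<in>A. f i) = (\<Sum>i\<in>A. rado_sum (f i))"
  by (simp_all add: rado_sum_def rat.lin_ext_add rat.lin_ext_diff rat.lin_ext_sum)

lemma rado_sum_zero [simp]: "rado_sum 0 = 0"
  by (simp add: rado_sum_def)

lemma rado_sum_scale: "rado_sum (p * Poly_Mapping.single 0 x) = rado_sum p * x"
  by (induction p rule: poly_mapping_induct_add) (simp_all add: mult_single distrib_right rado_sum_add)

text \<open>By linearity it suffices to test against monomials.\<close>

lemma rado_kernelI:
  assumes "\<And>m. rado_sum (p * Poly_Mapping.single m 1) = 0"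
  shows "p \<in> rado_kernel"
proof -
  have "rado_sum (p * q) = 0" for q
  proof (induction q rule: poly_mapping_induct_add)
    case (single m x)
    have "p * Poly_Mapping.single m x = p * Poly_Mapping.single m 1 * Poly_Mapping.single 0 x"
      by (simp add: mult.assoc mult_single)
    then show ?case by (simp add: assms rado_sum_scale)
  qed (simp add: distrib_left rado_sum_add)
  then show ?thesis by (simp add: rado_kernel_def)
qed

lemma rado_kernel_zero: "0 \<in> rado_kernel"
  by (simp add: rado_kernel_def)

lemma rado_kernel_add: "p \<in> rado_kernel \<Longrightarrow> q \<in> rado_kernel \<Longrightarrow> p + q \<in> rado_kernel"
  by (simp add: rado_kernel_def distrib_right rado_sum_add)

lemma rado_kernel_diff: "p \<in> rado_kernel \<Longrightarrow> q \<in> rado_kernel \<Longrightarrow> p - q \<in> rado_kernel"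
  by (simp add: rado_kernel_def left_diff_distrib rado_sum_diff)

lemma rado_kernel_sum: "(\<And>i. i \<in> A \<Longrightarrow> f i \<in> rado_kernel) \<Longrightarrow> (\<Sum>i\<in>A. f i) \<in> rado_kernel"
  by (induction A rule: infinite_finite_induct) (auto simp: rado_kernel_zero rado_kernel_add)

lemma rado_kernel_mult: "p \<in> rado_kernel \<Longrightarrow> p * q \<in> rado_kernel"
  by (simp add: rado_kernel_def mult.assoc)

section \<open>Relations between the h modulo the Rado kernel\<close>

lemma h_mult_single: "h S * Poly_Mapping.single m x = Poly_Mapping.single (add_mset S m) x"
  by (simp add: mult_single)

text \<open>Rado's condition fails for any family containing the empty set, whose rank is 0; the
  empty T witnesses this in \<open>slack\<close>.\<close>

lemma h_empty_in_kernel: "h {} \<in> rado_kernel"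
proof (rule rado_kernelI)
  fix m :: "'a set multiset"
  have "\<not> slack 1 m {}" unfolding slack_def by (auto intro!: exI[of _ "{#}"])
  then show "rado_sum (h {} * Poly_Mapping.single m 1) = 0"
    by (simp add: h_mult_single rado_add_mset)
qed

text \<open>Rado's condition sees a member only through its closure.\<close>

lemma h_cl_in_kernel:
  assumes "S \<subseteq> E"
  shows "h S - h (cl S) \<in> rado_kernel"
  by (rule rado_kernelI)
    (simp add: left_diff_distrib h_mult_single rado_sum_diff rado_add_mset assms cl_subset_ground)

text \<open>After multiplication by m the product has four terms, all requiring
  \<open>rado m\<close> and \<open>slack 2 m (F \<union> G)\<close>, hence also
  \<open>slack 1 m (F \<union> G)\<close>. Given these, their signed sum is (1 - a) (1 - b), where a
  and b are the truth values of \<open>slack 1 m F\<close> and \<open>slack 1 m G\<close>;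
  uncrossing says that one of them is 1.\<close>

lemma h_pair_in_kernel:
  assumes F: "F \<subseteq> E" and G: "G \<subseteq> E"
  shows "(h F - h (cl (F \<union> G))) * (h G - h (cl (F \<union> G))) \<in> rado_kernel"
proof (rule rado_kernelI)
  fix m :: "'a set multiset"
  let ?J = "cl (F \<union> G)" and ?s = "\<lambda>A B. Poly_Mapping.single (add_mset A (add_mset B m)) (1::rat)"
  have J: "?J \<subseteq> E" "F \<union> ?J = ?J" "G \<union> ?J = ?J" "?J \<union> G = ?J"
    using cl_subset_ground F G subset_cl[of "F \<union> G"] by auto
  have "(h F - h ?J) * (h G - h ?J) * Poly_Mapping.single m 1 = ?s F G - ?s F ?J - ?s ?J G + ?s ?J ?J"
    by (simp add: left_diff_distrib right_diff_distrib mult_single add_mset_commute)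
  moreover have "slack 1 m (F \<union> G) \<Longrightarrow> rado m \<Longrightarrow> slack 1 m F \<or> slack 1 m G"
    using slack_Un F G by blast
  moreover have "slack 2 m (F \<union> G) \<Longrightarrow> slack 1 m (F \<union> G)"
    by (rule slack_mono) auto
  moreover have
    "rado (add_mset F (add_mset G m)) \<longleftrightarrow> rado m \<and> slack 1 m F \<and> slack 1 m G \<and> slack 2 m (F \<union> G)"
    "rado (add_mset F (add_mset ?J m)) \<longleftrightarrow> rado m \<and> slack 1 m F \<and> slack 1 m (F \<union> G) \<and> slack 2 m (F \<union> G)"
    "rado (add_mset ?J (add_mset G m)) \<longleftrightarrow> rado m \<and> slack 1 m (F \<union> G) \<and> slack 1 m G \<and> slack 2 m (F \<union> G)"
    "rado (add_mset ?J (add_mset ?J m)) \<longleftrightarrow> rado m \<and> slack 1 m (F \<union> G) \<and> slack 2 m (F \<union> G)"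
    using F G J(1) by (simp_all only: rado_add_mset2 J(2-) slack_cl Un_absorb simp_thms)
  ultimately show "rado_sum ((h F - h ?J) * (h G - h ?J) * Poly_Mapping.single m 1) = 0"
    by (cases "slack 1 m F"; cases "slack 1 m G"; cases "slack 2 m (F \<union> G)"; cases "rado m")
      (simp_all add: rado_sum_add rado_sum_diff)
qed

text \<open>The element i raises ranks by at most one, so slack 2 at \<open>insert i F\<close> gives
  slack 1 at F. Hence Rado's condition holds for both monomials or for neither.\<close>

lemma h_singleton_in_kernel:
  assumes i: "i \<in> E" and F: "F \<subseteq> E"
  shows "h {i} * (h (cl (insert i F)) - h F) \<in> rado_kernel"
proof (rule rado_kernelI)
  fix m :: "'a set multiset"
  let ?J = "cl (insert i F)" and ?s = "\<lambda>A B. Poly_Mapping.single (add_mset A (add_mset B m)) (1::rat)"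
  have J: "?J \<subseteq> E" "insert i ?J = ?J"
    using cl_subset_ground[of "insert i F"] i F subset_cl[of "insert i F"] by auto
  have *: "h {i} * (h ?J - h F) * Poly_Mapping.single m 1 = ?s {i} ?J - ?s {i} F"
    by (simp add: left_diff_distrib right_diff_distrib mult_single add_mset_commute)
  have "slack 1 m F" if "rado m" "slack 2 m (insert i F)"
    unfolding slack_def
  proof (intro allI impI)
    fix T assume T: "T \<subseteq># m"
    have "size T + 2 \<le> rk (insert i (F \<union> \<Union>(set_mset T)))"
      using that(2) T by (simp add: slack_def)
    also have "\<dots> \<le> Suc (rk (F \<union> \<Union>(set_mset T)))"
      by (rule rk_insert_le) (use F i rado_Union_subset[OF that(1) T] in auto)
    finally show "size T + 1 \<le> rk (F \<union> \<Union>(set_mset T))" by simp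
  qed
  moreover have "slack 2 m (insert i F) \<Longrightarrow> slack 1 m (insert i F)"
    by (rule slack_mono) auto
  moreover have
    "rado (add_mset {i} (add_mset ?J m)) \<longleftrightarrow>
      rado m \<and> slack 1 m {i} \<and> slack 1 m (insert i F) \<and> slack 2 m (insert i F)"
    "rado (add_mset {i} (add_mset F m)) \<longleftrightarrow>
      rado m \<and> slack 1 m {i} \<and> slack 1 m F \<and> slack 2 m (insert i F)"
    using i F J by (simp_all add: rado_add_mset2)
  ultimately have "rado (add_mset {i} (add_mset ?J m)) = rado (add_mset {i} (add_mset F m))"
    by blast
  then show "rado_sum (h {i} * (h ?J - h F) * Poly_Mapping.single m 1) = 0"
    by (simp add: * rado_sum_diff)
qed

end

section \<open>Polynomial rings and their ideals\<close>

lemma mpoly_ring_simps: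
  "carrier (mpoly_ring V) = {p. \<forall>m\<in>Poly_Mapping.keys p. Poly_Mapping.keys m \<subseteq> V}"
  "p \<otimes>\<^bsub>mpoly_ring V\<^esub> q = p * q" "p \<oplus>\<^bsub>mpoly_ring V\<^esub> q = p + q"
  "\<one>\<^bsub>mpoly_ring V\<^esub> = 1" "\<zero>\<^bsub>mpoly_ring V\<^esub> = 0"
  by (simp_all add: mpoly_ring_def ring_of_type_algebra_def)

lemma keys_uminus: "Poly_Mapping.keys (- p) = Poly_Mapping.keys (p :: 'k \<Rightarrow>\<^sub>0 'b::ab_group_add)"
  by (auto simp: in_keys_iff)

lemma mpoly_carrier_zero: "0 \<in> carrier (mpoly_ring V)"
  and mpoly_carrier_one: "1 \<in> carrier (mpoly_ring V)"
  and mpoly_carrier_const: "mpoly_const c \<in> carrier (mpoly_ring V)"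
  and mpoly_carrier_var: "v \<in> V \<Longrightarrow> mpoly_var v \<in> carrier (mpoly_ring V)"
  by (auto simp: mpoly_ring_simps mpoly_const_def mpoly_var_def)

lemma mpoly_carrier_add:
  "p \<in> carrier (mpoly_ring V) \<Longrightarrow> q \<in> carrier (mpoly_ring V) \<Longrightarrow> p + q \<in> carrier (mpoly_ring V)"
  using keys_add[of p q] by (auto simp: mpoly_ring_simps)

lemma mpoly_carrier_uminus: "p \<in> carrier (mpoly_ring V) \<Longrightarrow> - p \<in> carrier (mpoly_ring V)"
  by (simp add: mpoly_ring_simps keys_uminus)

lemma mpoly_carrier_diff:
  "p \<in> carrier (mpoly_ring V) \<Longrightarrow> q \<in> carrier (mpoly_ring V) \<Longrightarrow> p - q \<in> carrier (mpoly_ring V)"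
  using mpoly_carrier_add[of p V "- q"] mpoly_carrier_uminus[of q V] by simp

lemma mpoly_carrier_mult:
  assumes "p \<in> carrier (mpoly_ring V)" "q \<in> carrier (mpoly_ring V)"
  shows "p * q \<in> carrier (mpoly_ring V)"
  unfolding mpoly_ring_simps
proof (intro CollectI ballI)
  fix m assume "m \<in> Poly_Mapping.keys (p * q)"
  then obtain a b where ab: "m = a + b" "a \<in> Poly_Mapping.keys p" "b \<in> Poly_Mapping.keys q"
    using keys_mult[of p q] by blast
  then show "Poly_Mapping.keys m \<subseteq> V"
    using assms keys_add[of a b] unfolding mpoly_ring_simps ab(1) by blast
qed

lemma mpoly_carrier_sum:
  "(\<And>i. i \<in> A \<Longrightarrow> p i \<in> carrier (mpoly_ring V)) \<Longrightarrow> (\<Sum>i\<in>A. p i) \<in> carrier (mpoly_ring V)"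
  by (induction A rule: infinite_finite_induct) (auto intro: mpoly_carrier_zero mpoly_carrier_add)

lemma mpoly_carrier_prod:
  "(\<And>i. i \<in> A \<Longrightarrow> p i \<in> carrier (mpoly_ring V)) \<Longrightarrow> (\<Prod>i\<in>A. p i) \<in> carrier (mpoly_ring V)"
  by (induction A rule: infinite_finite_induct) (auto intro: mpoly_carrier_one mpoly_carrier_mult)

lemmas mpoly_carrier_intros =
  mpoly_carrier_zero mpoly_carrier_one mpoly_carrier_const mpoly_carrier_var mpoly_carrier_add
  mpoly_carrier_uminus mpoly_carrier_diff mpoly_carrier_mult mpoly_carrier_sum mpoly_carrier_prod

text \<open>The operations are those of the whole polynomial type, so the laws come from the type
  class and the work is in the closure of the carrier.\<close>

lemma cring_mpoly_ring: "cring (mpoly_ring V)"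
proof (rule cringI)
  show "abelian_group (mpoly_ring V)"
  proof (rule abelian_groupI)
    fix p assume "p \<in> carrier (mpoly_ring V)"
    then show "\<exists>q\<in>carrier (mpoly_ring V). q \<oplus>\<^bsub>mpoly_ring V\<^esub> p = \<zero>\<^bsub>mpoly_ring V\<^esub>"
      using mpoly_carrier_uminus by (intro bexI[of _ "- p"]) (auto simp: mpoly_ring_simps(2-))
  qed (auto simp: mpoly_ring_simps(2-) algebra_simps intro: mpoly_carrier_intros)
  show "Group.comm_monoid (mpoly_ring V)"
    by (rule comm_monoidI) (auto simp: mpoly_ring_simps(2-) algebra_simps intro: mpoly_carrier_intros)
qed (auto simp: mpoly_ring_simps(2-) algebra_simps)

lemma ring_mpoly_ring: "ring (mpoly_ring V)"
  by (rule cring.axioms(1)[OF cring_mpoly_ring])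

lemma mpoly_ring_a_inv:
  assumes "p \<in> carrier (mpoly_ring V)"
  shows "\<ominus>\<^bsub>mpoly_ring V\<^esub> p = - p"
proof -
  interpret ring "mpoly_ring V" by (rule ring_mpoly_ring)
  show ?thesis
    by (rule minus_equality) (use assms in \<open>auto simp: mpoly_ring_simps(2-) intro: mpoly_carrier_intros\<close>)
qed

text \<open>Negation is multiplication by -1. Used to compare the Chow ideal, through its
  minimality, with ideals given as explicit sets.\<close>

lemma mpoly_idealI:
  assumes sub: "J \<subseteq> carrier (mpoly_ring V)" and zero: "0 \<in> J"
    and add: "\<And>p q. p \<in> J \<Longrightarrow> q \<in> J \<Longrightarrow> p + q \<in> J"
    and mult: "\<And>p q. p \<in> carrier (mpoly_ring V) \<Longrightarrow> q \<in> J \<Longrightarrow> p * q \<in> J"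
  shows "ideal J (mpoly_ring V)"
proof (rule idealI[OF ring_mpoly_ring])
  have minus: "\<ominus>\<^bsub>mpoly_ring V\<^esub> p \<in> J" if "p \<in> J" for p
  proof -
    have "p \<in> carrier (mpoly_ring V)" using sub that by blast
    moreover have "(- 1) * p \<in> J"
      by (rule mult[OF _ that]) (intro mpoly_carrier_intros)
    ultimately show ?thesis by (simp add: mpoly_ring_a_inv)
  qed
  show "subgroup J (add_monoid (mpoly_ring V))"
  proof (rule subgroup.intro)
    show "inv\<^bsub>add_monoid (mpoly_ring V)\<^esub> p \<in> J" if "p \<in> J" for p
      using minus[OF that] by (simp add: a_inv_def)
  qed (use sub zero add in \<open>auto simp: mpoly_ring_simps(2-)\<close>)
  show "p \<otimes>\<^bsub>mpoly_ring V\<^esub> q \<in> J" "q \<otimes>\<^bsub>mpoly_ring V\<^esub> p \<in> J"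
    if "q \<in> J" "p \<in> carrier (mpoly_ring V)" for p q
    using mult[OF that(2,1)] by (simp_all add: mpoly_ring_simps(2-) mult.commute)
qed

section \<open>The augmented Chow ring detects the flats\<close>

text \<open>The value at a minimal member F of N enters no equation but that of F, so the other
  equations are solved first and the value at F is then read off from its own.\<close>

lemma superset_sum_inversion:
  fixes g :: "'a set \<Rightarrow> 'b::ab_group_add"
  assumes "finite N"
  shows "\<exists>\<xi>. \<forall>F\<in>N. (\<Sum>G\<in>{G \<in> N. F \<subseteq> G}. \<xi> G) = g F"
  using assms
proof (induction "card N" arbitrary: N)
  case (Suc n)
  then have "N \<noteq> {}" by auto
  from finite_has_minimal[OF Suc.prems this]
  obtain F where F: "F \<in> N" "\<forall>G\<in>N. G \<subseteq> F \<longrightarrow> F = G" by (elim bexE)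
  have "n = card (N - {F})" "finite (N - {F})" using Suc F(1) by auto
  from Suc.hyps(1)[OF this]
  obtain \<xi> where \<xi>: "\<forall>G\<in>N - {F}. (\<Sum>H\<in>{H \<in> N - {F}. G \<subseteq> H}. \<xi> H) = g G" by blast
  \<comment> \<open>By minimality of F, this change affects only the equation at F.\<close>
  define \<zeta> where "\<zeta> = \<xi>(F := g F - (\<Sum>H\<in>{H \<in> N - {F}. F \<subseteq> H}. \<xi> H))"
  have \<zeta>_\<xi>: "(\<Sum>H\<in>{H \<in> N - {F}. G \<subseteq> H}. \<zeta> H) = (\<Sum>H\<in>{H \<in> N - {F}. G \<subseteq> H}. \<xi> H)" for G
    by (rule sum.cong) (auto simp: \<zeta>_def)
  have "(\<Sum>H\<in>{H \<in> N. G \<subseteq> H}. \<zeta> H) = g G" if G: "G \<in> N" for G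
  proof (cases "G = F")
    case True
    have "{H \<in> N. F \<subseteq> H} = insert F {H \<in> N - {F}. F \<subseteq> H}" using F by auto
    then show ?thesis using True Suc.prems by (simp add: \<zeta>_\<xi>) (simp add: \<zeta>_def)
  next
    case False
    have eq: "{H \<in> N. G \<subseteq> H} = {H \<in> N - {F}. G \<subseteq> H}" using F G False by auto
    show ?thesis unfolding eq \<zeta>_\<xi> using \<xi> False G by blast
  qed
  then show ?case by blast
qed auto

context matroid
begin

text \<open>The image of the variable \<open>x\<^sub>F\<close>, obtained by Moebius inversion from the sums \<open>h\<^sub>E - h\<^sub>F\<close>.\<close>

definition xi :: "'a set \<Rightarrow> ('a set multiset \<Rightarrow>\<^sub>0 rat)" where
  "xi = (SOME \<xi>. \<forall>F\<in>M - {E}. (\<Sum>G\<in>{G \<in> M - {E}. F \<subseteq> G}. \<xi> G) = h E - h F)"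

section \<open>The Chow relations for the elements \<open>xi\<close>\<close>

lemma finite_proper_flats: "finite (M - {E})"
  using finite_flats by blast

text \<open>At F = E the sum is empty and the right side zero. This case is included because joins
  of proper flats may equal E.\<close>

lemma sum_xi:
  assumes "F \<in> M"
  shows "(\<Sum>G\<in>{G \<in> M - {E}. F \<subseteq> G}. xi G) = h E - h F"
proof (cases "F = E")
  case True
  then have empty: "{G \<in> M - {E}. F \<subseteq> G} = {}" using flat_subset by blast
  show ?thesis unfolding empty by (simp add: True)
next
  case False
  have "\<forall>F\<in>M - {E}. (\<Sum>G\<in>{G \<in> M - {E}. F \<subseteq> G}. xi G) = h E - h F"
    unfolding xi_def using superset_sum_inversion[OF finite_proper_flats, of "\<lambda>F. h E - h F"]
    by (rule someI_ex)
  then show ?thesis using assms False by blast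
qed

lemma sum_xi_between:
  assumes "F \<in> M" "J \<in> M" "F \<subseteq> J"
  shows "(\<Sum>G\<in>{G \<in> M - {E}. F \<subseteq> G \<and> \<not> J \<subseteq> G}. xi G) = h J - h F"
proof -
  have "{G \<in> M - {E}. F \<subseteq> G \<and> \<not> J \<subseteq> G} = {G \<in> M - {E}. F \<subseteq> G} - {G \<in> M - {E}. J \<subseteq> G}"
    by blast
  moreover have "{G \<in> M - {E}. J \<subseteq> G} \<subseteq> {G \<in> M - {E}. F \<subseteq> G}" using assms by blast
  ultimately show ?thesis
    using finite_proper_flats sum_xi[OF assms(1)] sum_xi[OF assms(2)] by (simp add: sum_diff)
qed

lemma card_complement_less:
  assumes "F \<in> M" "A \<in> M" "F \<subset> A"
  shows "card (E - A) < card (E - F)"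
  by (rule psubset_card_mono) (use assms flat_subset finite_ground in blast)+

lemma card_complement_le: "F \<subseteq> A \<Longrightarrow> card (E - A) \<le> card (E - F)"
  by (rule card_mono) (use finite_ground in auto)

text \<open>Induction from large flats downwards. The sums of \<open>xi\<close> over the flats above
  F, respectively G, but not above the join J multiply to the quadratic relation; every term other
  than \<open>xi F * xi G\<close> belongs to an incomparable pair of larger flats.\<close>

lemma xi_incomparable_in_kernel:
  assumes "F \<in> M - {E}" "G \<in> M - {E}" "\<not> F \<subseteq> G" "\<not> G \<subseteq> F"
  shows "xi F * xi G \<in> rado_kernel"
  using assms
proof (induction "card (E - F) + card (E - G)" arbitrary: F G rule: less_induct)
  case less
  define J where "J = cl (F \<union> G)"
  define \<A> where "\<A> = {A \<in> M - {E}. F \<subseteq> A \<and> \<not> J \<subseteq> A}"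
  define \<B> where "\<B> = {B \<in> M - {E}. G \<subseteq> B \<and> \<not> J \<subseteq> B}"
  have FG: "F \<in> M" "G \<in> M" "F \<subseteq> E" "G \<subseteq> E" using less.prems flat_subset by auto
  have J: "J \<in> M" "F \<subseteq> J" "G \<subseteq> J"
    unfolding J_def using FG cl_flat subset_cl[of "F \<union> G"] by auto
  have \<A>: "\<not> G \<subseteq> A" if "A \<in> \<A>" for A
    using that cl_minimal[of "F \<union> G" A] unfolding \<A>_def J_def by blast
  have \<B>: "\<not> F \<subseteq> B" if "B \<in> \<B>" for B
    using that cl_minimal[of "F \<union> G" B] unfolding \<B>_def J_def by blast
  have fin: "finite (\<A> \<times> \<B>)" using finite_proper_flats by (simp add: \<A>_def \<B>_def)
  have FGin: "(F, G) \<in> \<A> \<times> \<B>" using less.prems J by (auto simp: \<A>_def \<B>_def)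
  let ?f = "\<lambda>(A, B). xi A * xi B"
  have "sum xi \<A> = h J - h F" "sum xi \<B> = h J - h G"
    unfolding \<A>_def \<B>_def by (rule sum_xi_between; fact)+
  then have "sum ?f (\<A> \<times> \<B>) = (h J - h F) * (h J - h G)"
    by (metis sum_product sum.cartesian_product)
  also have "\<dots> = (h F - h J) * (h G - h J)" by (simp add: algebra_simps)
  also have "\<dots> \<in> rado_kernel" unfolding J_def by (rule h_pair_in_kernel[OF FG(3,4)])
  finally have total: "sum ?f (\<A> \<times> \<B>) \<in> rado_kernel" .
  have others: "sum ?f (\<A> \<times> \<B> - {(F, G)}) \<in> rado_kernel"
  proof (rule rado_kernel_sum)
    fix z assume z: "z \<in> \<A> \<times> \<B> - {(F, G)}"
    then obtain A B where AB: "z = (A, B)" "A \<in> \<A>" "B \<in> \<B>" "A \<noteq> F \<or> B \<noteq> G" by auto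
    then have sub: "A \<in> M - {E}" "B \<in> M - {E}" "F \<subseteq> A" "G \<subseteq> B"
      by (auto simp: \<A>_def \<B>_def)
    have "xi A * xi B \<in> rado_kernel"
    proof (rule less.hyps)
      show "card (E - A) + card (E - B) < card (E - F) + card (E - G)"
      proof (cases "A = F")
        case True
        then show ?thesis using card_complement_less[of G B] AB sub FG by auto
      next
        case False
        then have "card (E - A) < card (E - F)" using card_complement_less[of F A] sub FG by auto
        then show ?thesis using card_complement_le[OF sub(4)] by linarith
      qed
      \<comment> \<open>If A were inside B, then B would contain both F and G and so J, against its
        choice; likewise with A and B exchanged.\<close>
      show "\<not> A \<subseteq> B" "\<not> B \<subseteq> A" using \<A>[OF AB(2)] \<B>[OF AB(3)] sub by blast+
    qed (use sub in auto)
    then show "?f z \<in> rado_kernel" using AB(1) by simp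
  qed
  have "sum ?f (\<A> \<times> \<B>) = xi F * xi G + sum ?f (\<A> \<times> \<B> - {(F, G)})"
    using sum.remove[OF fin FGin, of ?f] by simp
  then show ?case using rado_kernel_diff[OF total others] by simp
qed

text \<open>The same downward induction with one sum: it runs over the flats above F but not above
  J, the closure of \<open>insert i F\<close>, and none of these contains i.\<close>

lemma h_xi_in_kernel:
  assumes "i \<in> E" "F \<in> M - {E}" "i \<notin> F"
  shows "h {i} * xi F \<in> rado_kernel"
  using assms(2,3)
proof (induction "card (E - F)" arbitrary: F rule: less_induct)
  case less
  define J where "J = cl (insert i F)"
  define \<A> where "\<A> = {A \<in> M - {E}. F \<subseteq> A \<and> \<not> J \<subseteq> A}"
  have F: "F \<in> M" "F \<subseteq> E" using less.prems flat_subset by auto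
  have J: "J \<in> M" "F \<subseteq> J" "i \<in> J"
    unfolding J_def using F assms(1) cl_flat subset_cl[of "insert i F"] by auto
  have \<A>: "i \<notin> A" if "A \<in> \<A>" for A
    using that cl_minimal[of "insert i F" A] unfolding \<A>_def J_def by blast
  have fin: "finite \<A>" using finite_proper_flats by (simp add: \<A>_def)
  have Fin: "F \<in> \<A>" using less.prems J by (auto simp: \<A>_def)
  have total: "h {i} * sum xi \<A> \<in> rado_kernel"
    unfolding \<A>_def sum_xi_between[OF F(1) J(1,2)] unfolding J_def
    by (rule h_singleton_in_kernel[OF assms(1) F(2)])
  have others: "(\<Sum>A\<in>\<A> - {F}. h {i} * xi A) \<in> rado_kernel"
  proof (rule rado_kernel_sum)
    fix A assume A: "A \<in> \<A> - {F}"
    then have "A \<in> M - {E}" "F \<subset> A" by (auto simp: \<A>_def)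
    then show "h {i} * xi A \<in> rado_kernel"
      using less.hyps card_complement_less[OF F(1)] \<A> A by blast
  qed
  have "h {i} * sum xi \<A> = h {i} * xi F + (\<Sum>A\<in>\<A> - {F}. h {i} * xi A)"
    unfolding sum_distrib_left by (rule sum.remove[OF fin Fin])
  then show ?case using rado_kernel_diff[OF total others] by simp
qed

text \<open>A flat omits i exactly when it is not above \<open>cl {i}\<close>, and every flat is
  above \<open>cl {}\<close>; so the sum is \<open>h (cl {i}) - h (cl {})\<close>. Passing to
  \<open>h {i}\<close> and \<open>h {}\<close> costs only elements of the kernel, and
  \<open>h {}\<close> lies there too.\<close>

lemma linear_relation_in_kernel:
  assumes "i \<in> E"
  shows "h {i} - (\<Sum>F\<in>{F \<in> M - {E}. i \<notin> F}. xi F) \<in> rado_kernel"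
proof -
  have fl: "cl {} \<in> M" "cl {i} \<in> M" "cl {} \<subseteq> cl {i}" using cl_flat assms cl_mono by auto
  have "cl {} \<subseteq> F" if "F \<in> M" for F by (rule cl_empty_subset[OF that])
  moreover have "cl {i} \<subseteq> F \<longleftrightarrow> i \<in> F" if "F \<in> M" for F
    using cl_minimal[of "{i}" F] subset_cl[of "{i}"] that by blast
  ultimately have "{F \<in> M - {E}. i \<notin> F} = {F \<in> M - {E}. cl {} \<subseteq> F \<and> \<not> cl {i} \<subseteq> F}"
    by blast
  then have "h {i} - (\<Sum>F\<in>{F \<in> M - {E}. i \<notin> F}. xi F) = (h {i} - h (cl {i})) + (h {} - (h {} - h (cl {})))"
    using sum_xi_between[OF fl] by simp
  also have "\<dots> \<in> rado_kernel"
    by (rule rado_kernel_add[OF h_cl_in_kernel rado_kernel_diff[OF h_empty_in_kernel h_cl_in_kernel]])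
      (use assms in auto)
  finally show ?thesis .
qed

section \<open>Evaluation of Chow polynomials in the h\<close>

definition chow_eval :: "'a chow_var rat_mpoly \<Rightarrow> ('a set multiset \<Rightarrow>\<^sub>0 rat)" where
  "chow_eval = mpoly_eval (\<lambda>v. case v of YVar i \<Rightarrow> h {i} | XVar F \<Rightarrow> xi F)"

abbreviation chow_polys :: "'a chow_var rat_mpoly set" where
  "chow_polys \<equiv> carrier (mpoly_ring (chow_vars E M))"

abbreviation y :: "'a \<Rightarrow> 'a chow_var rat_mpoly" where
  "y i \<equiv> mpoly_var (YVar i)"

abbreviation x :: "'a set \<Rightarrow> 'a chow_var rat_mpoly" where
  "x F \<equiv> mpoly_var (XVar F)"

lemma y_carrier: "i \<in> E \<Longrightarrow> y i \<in> chow_polys"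
  and x_carrier: "F \<in> M - {E} \<Longrightarrow> x F \<in> chow_polys"
  by (auto intro!: mpoly_carrier_var simp: chow_vars_def)

lemma chow_relations_carrier: "chow_relations E M \<subseteq> chow_polys"
  unfolding chow_relations_def
  by (auto intro!: mpoly_carrier_diff mpoly_carrier_mult mpoly_carrier_sum y_carrier x_carrier)

lemma ideal_chow_ideal: "ideal (chow_ideal E M) (mpoly_ring (chow_vars E M))"
  unfolding chow_ideal_def chow_poly_ring_def
  by (rule ring.genideal_ideal[OF ring_mpoly_ring chow_relations_carrier])

lemma chow_relations_in_ideal: "chow_relations E M \<subseteq> chow_ideal E M"
  unfolding chow_ideal_def chow_poly_ring_def
  by (rule ring.genideal_self[OF ring_mpoly_ring chow_relations_carrier])

lemma chow_ideal_minimal: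
  "ideal J (mpoly_ring (chow_vars E M)) \<Longrightarrow> chow_relations E M \<subseteq> J \<Longrightarrow> chow_ideal E M \<subseteq> J"
  unfolding chow_ideal_def chow_poly_ring_def
  by (rule ring.genideal_minimal[OF ring_mpoly_ring])

text \<open>The polynomials whose value lies in \<open>rado_kernel\<close> form an ideal, so by
  minimality only the three families of generators have to be checked.\<close>

lemma chow_eval_ideal:
  assumes "p \<in> chow_ideal E M"
  shows "chow_eval p \<in> rado_kernel"
proof -
  let ?J = "{p \<in> chow_polys. chow_eval p \<in> rado_kernel}"
  have "ideal ?J (mpoly_ring (chow_vars E M))"
  proof (rule mpoly_idealI)
    show "p * q \<in> ?J" if "p \<in> chow_polys" "q \<in> ?J" for p q
      using that rado_kernel_mult[of "chow_eval q" "chow_eval p"] mpoly_carrier_mult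
      by (auto simp: chow_eval_def mpoly_eval_mult mult.commute)
  qed (auto simp: chow_eval_def mpoly_eval_add rado_kernel_zero
      intro: mpoly_carrier_intros rado_kernel_add)
  moreover have "chow_relations E M \<subseteq> ?J"
  proof
    fix r assume r: "r \<in> chow_relations E M"
    then consider (lin) i where "i \<in> E" "r = y i - (\<Sum>F\<in>{F \<in> M - {E}. i \<notin> F}. x F)"
      | (xx) F G where "F \<in> M - {E}" "G \<in> M - {E}" "\<not> F \<subseteq> G" "\<not> G \<subseteq> F" "r = x F * x G"
      | (yx) i F where "i \<in> E" "F \<in> M - {E}" "i \<notin> F" "r = y i * x F"
      unfolding chow_relations_def by blast
    then have "chow_eval r \<in> rado_kernel"
    proof cases
      case lin
      then show ?thesis
        using linear_relation_in_kernel[of i] by (simp add: chow_eval_def mpoly_eval_diff mpoly_eval_sum)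
    next
      case xx
      then show ?thesis
        using xi_incomparable_in_kernel[of F G] by (simp add: chow_eval_def mpoly_eval_mult)
    next
      case yx
      then show ?thesis
        using h_xi_in_kernel[of i F] by (simp add: chow_eval_def mpoly_eval_mult)
    qed
    then show "r \<in> ?J" using chow_relations_carrier r by blast
  qed
  ultimately show ?thesis using chow_ideal_minimal assms by blast
qed

section \<open>Linear independence of the basis products\<close>

lemma chow_eval_prod_y:
  "finite I \<Longrightarrow> chow_eval (\<Prod>i\<in>I. y i) = Poly_Mapping.single (image_mset (\<lambda>i. {i}) (mset_set I)) 1"
  by (induction I rule: finite_induct) (simp_all add: chow_eval_def mpoly_eval_mult mult_single)

text \<open>Induction through \<open>slack_add_mset\<close> avoids describing the submultisets of an
  image: a subset of \<open>insert i I\<close> that contains i adds i to S and one to j.\<close>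

lemma slack_singletons:
  assumes "finite I"
  shows "slack j (image_mset (\<lambda>i. {i}) (mset_set I)) S \<longleftrightarrow> (\<forall>J\<subseteq>I. card J + j \<le> rk (S \<union> J))"
  using assms
proof (induction I arbitrary: j S)
  case empty
  show ?case by (auto simp: slack_def)
next
  case (insert i I)
  have fin: "finite J" if "J \<subseteq> I" for J using that insert(1) finite_subset by blast
  have "(\<forall>J\<subseteq>insert i I. card J + j \<le> rk (S \<union> J)) \<longleftrightarrow>
      (\<forall>J\<subseteq>I. card J + j \<le> rk (S \<union> J)) \<and> (\<forall>J\<subseteq>I. card J + Suc j \<le> rk (S \<union> {i} \<union> J))"
    (is "?L \<longleftrightarrow> ?R")
  proof
    assume L: ?L
    show ?R
    proof (intro conjI allI impI)
      fix J assume J: "J \<subseteq> I"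
      show "card J + j \<le> rk (S \<union> J)" using L J by blast
      have "card (insert i J) + j \<le> rk (S \<union> insert i J)" using L J by blast
      moreover have "i \<notin> J" using J insert(2) by blast
      ultimately show "card J + Suc j \<le> rk (S \<union> {i} \<union> J)" using J fin by simp
    qed
  next
    assume R: ?R
    show ?L
    proof (intro allI impI)
      fix J assume J: "J \<subseteq> insert i I"
      show "card J + j \<le> rk (S \<union> J)"
      proof (cases "i \<in> J")
        case True
        have "finite J" using finite_subset[OF J] insert(1) by simp
        then have "card J = Suc (card (J - {i}))" "S \<union> {i} \<union> (J - {i}) = S \<union> J"
          using card.remove[of J i] True by auto
        moreover have "J - {i} \<subseteq> I" using J by blast
        then have "card (J - {i}) + Suc j \<le> rk (S \<union> {i} \<union> (J - {i}))" using R by blast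
        ultimately show ?thesis by simp
      next
        case False
        then show ?thesis using R J by (simp add: subset_insert)
      qed
    qed
  qed
  then show ?case using insert by (simp add: slack_add_mset)
qed

text \<open>For a family of singletons Rado's condition says that all subsets of I are
  independent.\<close>

lemma rado_sum_basis:
  assumes "flat_basis E M F I"
  shows "rado_sum (chow_eval (\<Prod>i\<in>I. y i)) = 1"
proof -
  note I = flat_basisD[OF assms]
  have "slack 0 (image_mset (\<lambda>i. {i}) (mset_set I)) {}"
    using indep_subset[OF I(1)] by (auto simp: slack_singletons[OF I(7)] indep_iff)
  then have "rado (image_mset (\<lambda>i. {i}) (mset_set I))"
    using I by (auto simp: rado_def)
  then show ?thesis by (simp add: chow_eval_prod_y[OF I(7)])
qed

text \<open>If G lies in F, then J = I violates the condition, as G adds nothing to the rank of I.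
  Otherwise some g in G lies outside F, hence outside the closure of every J in I, and raises its
  rank by one.\<close>

lemma rado_sum_basis_h:
  assumes "flat_basis E M F I" and G: "G \<in> M"
  shows "rado_sum (chow_eval (\<Prod>i\<in>I. y i) * h G) = of_bool (\<not> G \<subseteq> F)"
proof -
  note I = flat_basisD[OF assms(1)]
  let ?m = "image_mset (\<lambda>i. {i}) (mset_set I)"
  have rado: "rado ?m"
    using rado_sum_basis[OF assms(1)] by (simp add: chow_eval_prod_y[OF I(7)] split: if_splits)
  have "slack 1 ?m G \<longleftrightarrow> \<not> G \<subseteq> F"
  proof
    assume "slack 1 ?m G"
    then have "card I + 1 \<le> rk (G \<union> I)" using slack_singletons[OF I(7)] by blast
    moreover have "rk (G \<union> I) \<le> card I" if "G \<subseteq> F"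
      using rk_mono[of "G \<union> I" F] that I flat_subset[OF I(5)] cl_of_flat[OF I(5)] by auto
    ultimately show "\<not> G \<subseteq> F" by linarith
  next
    assume "\<not> G \<subseteq> F"
    then obtain g where g: "g \<in> G" "g \<notin> F" by blast
    have gE: "g \<in> E" using g G flat_subset by blast
    show "slack 1 ?m G" unfolding slack_singletons[OF I(7)]
    proof (intro allI impI)
      fix J assume J: "J \<subseteq> I"
      have "matroid_indep E M J" using indep_subset[OF I(1) J] .
      moreover have "g \<notin> cl J" using g cl_mono[OF J] I(2) by blast
      ultimately have "card J + 1 = rk (insert g J)"
        using rk_insert[of J g] gE by (simp add: indep_iff)
      also have "\<dots> \<le> rk (G \<union> J)"
        by (rule rk_mono) (use g J I(4) flat_subset[OF G] in auto)
      finally show "card J + 1 \<le> rk (G \<union> J)" .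
    qed
  qed
  then show ?thesis
    using rado flat_subset[OF G] by (simp add: chow_eval_prod_y[OF I(7)] mult_single rado_add_mset)
qed

text \<open>Testing with 1 gives the sum of all a F, testing with \<open>h G\<close> the sum over
  the F not above G; their difference is the sum over the F above G. This system is triangular for
  inclusion.\<close>

lemma basis_products_independent:
  assumes N: "finite N" "N \<subseteq> M" and B: "\<And>F. F \<in> N \<Longrightarrow> flat_basis E M F (B F)"
    and ideal: "(\<Sum>F\<in>N. mpoly_const (a F) * (\<Prod>i\<in>B F. y i)) \<in> chow_ideal E M"
    and F: "F \<in> N"
  shows "a F = 0"
proof -
  let ?p = "\<Sum>F\<in>N. mpoly_const (a F) * (\<Prod>i\<in>B F. y i)"
  have test: "(\<Sum>F\<in>N. a F * rado_sum (chow_eval (\<Prod>i\<in>B F. y i) * q)) = 0" for q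
  proof -
    have "rado_sum (chow_eval ?p * q) = 0"
      using chow_eval_ideal[OF ideal] by (simp add: rado_kernel_def)
    moreover have "chow_eval ?p * q =
        (\<Sum>F\<in>N. chow_eval (\<Prod>i\<in>B F. y i) * q * Poly_Mapping.single 0 (a F))"
      unfolding chow_eval_def mpoly_eval_sum mpoly_eval_mult sum_distrib_right mpoly_eval_const
      by (rule sum.cong) (simp_all only: mult_ac)
    ultimately have "(\<Sum>F\<in>N. rado_sum (chow_eval (\<Prod>i\<in>B F. y i) * q) * a F) = 0"
      by (simp only: rado_sum_sum rado_sum_scale)
    then show ?thesis by (simp add: mult.commute)
  qed
  have above: "(\<Sum>F\<in>{F \<in> N. G \<subseteq> F}. a F) = 0" if G: "G \<in> M" for G
  proof -
    have "(\<Sum>F\<in>N. a F) = 0"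
      using test[of 1] by (simp add: rado_sum_basis[OF B] cong: sum.cong)
    moreover have "(\<Sum>F\<in>N. a F * of_bool (\<not> G \<subseteq> F)) = 0"
      using test[of "h G"] by (simp add: rado_sum_basis_h[OF B G] cong: sum.cong)
    moreover have "(\<Sum>F\<in>{F \<in> N. G \<subseteq> F}. a F) = (\<Sum>F\<in>N. a F - a F * of_bool (\<not> G \<subseteq> F))"
      using N(1) by (subst sum.inter_filter) (auto intro!: sum.cong)
    ultimately show ?thesis by (simp add: sum_subtractf)
  qed
  show ?thesis using F
  proof (induction "card (E - F)" arbitrary: F rule: less_induct)
    case less
    have FM: "F \<in> M" using less.prems N by blast
    \<comment> \<open>Strictly larger flats already have coefficient 0, so only \<open>a F\<close>
      is left of the sum above F.\<close>
    have "(\<Sum>G\<in>{G \<in> N. F \<subseteq> G} - {F}. a G) = 0"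
    proof (rule sum.neutral, rule)
      fix G assume "G \<in> {G \<in> N. F \<subseteq> G} - {F}"
      then show "a G = 0" using less.hyps card_complement_less[OF FM, of G] N(2) by blast
    qed
    then show ?case
      using above[OF FM] sum.remove[of "{G \<in> N. F \<subseteq> G}" F a] N(1) less.prems by simp
  qed
qed

end

section \<open>Products of the linear forms modulo the Chow ideal\<close>

context matroid
begin

section \<open>Arithmetic in the Chow ideal and its relations\<close>

lemma chow_ideal_zero: "0 \<in> chow_ideal E M"
  using additive_subgroup.zero_closed[OF ideal.axioms(1)[OF ideal_chow_ideal]]
  by (simp add: mpoly_ring_simps)

lemma chow_ideal_add: "p \<in> chow_ideal E M \<Longrightarrow> q \<in> chow_ideal E M \<Longrightarrow> p + q \<in> chow_ideal E M"
  using additive_subgroup.a_closed[OF ideal.axioms(1)[OF ideal_chow_ideal]]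
  by (simp add: mpoly_ring_simps)

lemma chow_ideal_mult: "p \<in> chow_polys \<Longrightarrow> q \<in> chow_ideal E M \<Longrightarrow> p * q \<in> chow_ideal E M"
  using ideal.I_l_closed[OF ideal_chow_ideal] by (simp add: mpoly_ring_simps)

lemma chow_ideal_mult2: "p \<in> chow_ideal E M \<Longrightarrow> q \<in> chow_polys \<Longrightarrow> p * q \<in> chow_ideal E M"
  using chow_ideal_mult[of q p] by (simp add: mult.commute)

lemma chow_ideal_uminus:
  assumes "p \<in> chow_ideal E M"
  shows "- p \<in> chow_ideal E M"
proof -
  have "(- 1) * p \<in> chow_ideal E M"
    by (rule chow_ideal_mult[OF _ assms]) (intro mpoly_carrier_intros)
  then show ?thesis by simp
qed

lemma chow_ideal_diff: "p \<in> chow_ideal E M \<Longrightarrow> q \<in> chow_ideal E M \<Longrightarrow> p - q \<in> chow_ideal E M"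
  using chow_ideal_add[of p "- q"] chow_ideal_uminus[of q] by simp

lemma chow_ideal_sum: "(\<And>i. i \<in> A \<Longrightarrow> f i \<in> chow_ideal E M) \<Longrightarrow> (\<Sum>i\<in>A. f i) \<in> chow_ideal E M"
  by (induction A rule: infinite_finite_induct) (auto intro: chow_ideal_zero chow_ideal_add)

lemma y_linear_relation: "i \<in> E \<Longrightarrow> y i - (\<Sum>F\<in>{F \<in> M - {E}. i \<notin> F}. x F) \<in> chow_ideal E M"
  by (rule set_mp[OF chow_relations_in_ideal]) (auto simp: chow_relations_def)

lemma y_x_relation: "i \<in> E \<Longrightarrow> F \<in> M - {E} \<Longrightarrow> i \<notin> F \<Longrightarrow> y i * x F \<in> chow_ideal E M"
  by (rule set_mp[OF chow_relations_in_ideal]) (auto simp: chow_relations_def)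

text \<open>Multisets, because the product of two basis products repeats a factor when the bases
  meet.\<close>

abbreviation y_mset :: "'a multiset \<Rightarrow> 'a chow_var rat_mpoly" where
  "y_mset m \<equiv> \<Prod>i\<in>#m. y i"

lemma y_mset_carrier: "set_mset m \<subseteq> E \<Longrightarrow> y_mset m \<in> chow_polys"
  by (induction m) (auto intro: mpoly_carrier_one mpoly_carrier_mult y_carrier)

lemma y_prod_carrier: "I \<subseteq> E \<Longrightarrow> (\<Prod>i\<in>I. y i) \<in> chow_polys"
  by (auto intro!: mpoly_carrier_prod y_carrier)

lemma y_mset_x:
  assumes m: "set_mset m \<subseteq> E" and F: "F \<in> M - {E}" and sub: "\<not> set_mset m \<subseteq> F"
  shows "y_mset m * x F \<in> chow_ideal E M"
proof -
  obtain i where i: "i \<in># m" "i \<notin> F" using sub by blast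
  then obtain m' where m': "m = add_mset i m'" by (metis mset_add)
  have "y_mset m' * (y i * x F) \<in> chow_ideal E M"
    using m i F unfolding m' by (intro chow_ideal_mult y_mset_carrier y_x_relation) auto
  then show ?thesis by (simp add: m' mult_ac)
qed

text \<open>The linear relation of i is multiplied by y_m, and the terms with m not inside F vanish.
  Writing the remaining index set with closures shows that it depends on i only through the flat
  that i and m span.\<close>

lemma y_mset_y:
  assumes m: "set_mset m \<subseteq> E" and i: "i \<in> E"
  shows "y_mset m * y i - (\<Sum>F\<in>{F \<in> M - {E}. cl (set_mset m) \<subseteq> F \<and> \<not> cl (insert i (set_mset m)) \<subseteq> F}. y_mset m * x F)
    \<in> chow_ideal E M"
proof -
  let ?N = "{F \<in> M - {E}. i \<notin> F}"
  let ?P = "{F \<in> ?N. set_mset m \<subseteq> F}" and ?Q = "{F \<in> ?N. \<not> set_mset m \<subseteq> F}"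
  have fin: "finite ?P" "finite ?Q" using finite_proper_flats by auto
  have N: "?N = ?P \<union> ?Q" by blast
  have split: "(\<Sum>F\<in>?N. y_mset m * x F) = (\<Sum>F\<in>?P. y_mset m * x F) + (\<Sum>F\<in>?Q. y_mset m * x F)"
    by (subst N, rule sum.union_disjoint) (use fin in auto)
  have P: "?P = {F \<in> M - {E}. cl (set_mset m) \<subseteq> F \<and> \<not> cl (insert i (set_mset m)) \<subseteq> F}"
  proof -
    have cl_sub: "cl S \<subseteq> F \<longleftrightarrow> S \<subseteq> F" if "F \<in> M" for S F
      using cl_minimal[OF _ that] subset_cl[of S] by blast
    have "cl (set_mset m) \<subseteq> F \<and> \<not> cl (insert i (set_mset m)) \<subseteq> F \<longleftrightarrow> i \<notin> F \<and> set_mset m \<subseteq> F"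
      if "F \<in> M" for F
      using cl_sub[OF that] by auto
    then show ?thesis by blast
  qed
  have "y_mset m * (y i - (\<Sum>F\<in>?N. x F)) + (\<Sum>F\<in>?Q. y_mset m * x F) \<in> chow_ideal E M"
    by (rule chow_ideal_add[OF chow_ideal_mult[OF y_mset_carrier[OF m] y_linear_relation[OF i]] chow_ideal_sum])
      (use y_mset_x[OF m] in blast)
  then show ?thesis
    unfolding P[symmetric] right_diff_distrib sum_distrib_left split by simp
qed

lemma y_mset_y_cong:
  assumes m: "set_mset m \<subseteq> E" and ij: "i \<in> E" "j \<in> E"
    and cl: "cl (insert i (set_mset m)) = cl (insert j (set_mset m))"
  shows "y_mset m * y i - y_mset m * y j \<in> chow_ideal E M"
  using chow_ideal_diff[OF y_mset_y[OF m ij(1)] y_mset_y[OF m ij(2)]] by (simp add: cl)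

lemma y_mset_y_redundant:
  assumes m: "set_mset m \<subseteq> E" and i: "i \<in> E" "i \<in> cl (set_mset m)"
  shows "y_mset m * y i \<in> chow_ideal E M"
proof -
  have "{F \<in> M - {E}. cl (set_mset m) \<subseteq> F \<and> \<not> cl (insert i (set_mset m)) \<subseteq> F} = {}"
    using cl_redundant[OF i(2)] by auto
  then show ?thesis using y_mset_y[OF m i(1)] by (simp only: sum.empty diff_0_right)
qed

text \<open>Multiplying in one factor at a time, the rank must fail to grow at some factor; that
  factor lies in the closure of the previous ones and kills the product. Repeated factors are
  included.\<close>

lemma y_mset_dependent:
  assumes "set_mset m \<subseteq> E" "rk (set_mset m) < size m"
  shows "y_mset m \<in> chow_ideal E M"
  using assms
proof (induction m)
  case (add i m)
  have E: "set_mset m \<subseteq> E" "i \<in> E" using add.prems by auto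
  have "y_mset m * y i \<in> chow_ideal E M"
  proof (cases "rk (set_mset m) < size m")
    case True
    then show ?thesis using add.IH E y_carrier chow_ideal_mult2 by blast
  next
    case False
    then have "i \<in> cl (set_mset m)"
      using add.prems rk_insert[OF E] by (auto split: if_splits)
    then show ?thesis using y_mset_y_redundant E by blast
  qed
  then show ?case by (simp add: mult.commute)
qed simp

text \<open>One exchange replaces y_i by y_j next to y_A, where i and j span the same flat over A.
  This is what makes the definite description \<open>chow_y\<close> meaningful.\<close>

lemma y_prod_basis_cong:
  assumes "flat_basis E M F I" "flat_basis E M F J"
  shows "(\<Prod>i\<in>I. y i) - (\<Prod>j\<in>J. y j) \<in> chow_ideal E M"
  using assms
proof (induction rule: basis_exchange_induct)
  case (refl I)
  then show ?case by (simp add: chow_ideal_zero)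
next
  case (step A i j J)
  have fin: "finite A" using step.hyps(3) finite_ground finite_subset by blast
  have "y_mset (mset_set A) * y i - y_mset (mset_set A) * y j \<in> chow_ideal E M"
    by (rule y_mset_y_cong) (use step fin in auto)
  then have "(\<Prod>i\<in>insert i A. y i) - (\<Prod>i\<in>insert j A. y i) \<in> chow_ideal E M"
    using step.hyps fin by (simp add: prod_unfold_prod_mset mult.commute)
  from chow_ideal_add[OF this step.IH] show ?case by simp
qed

section \<open>Products of two basis products\<close>

lemma rk_join_bases:
  assumes "flat_basis E M F I" "flat_basis E M G J"
  shows "flat_join M F G = cl (I \<union> J)"
proof -
  have "flat_join M F G = cl (cl I \<union> cl J)"
    using flat_basisD(2)[OF assms(1)] flat_basisD(2)[OF assms(2)] by (simp add: flat_join_def)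
  also have "\<dots> = cl (I \<union> J)" by (metis cl_Un_left Un_commute)
  finally show ?thesis .
qed

lemma flat_join_flat: "F \<in> M \<Longrightarrow> G \<in> M \<Longrightarrow> flat_join M F G \<in> M"
  unfolding flat_join_def using cl_flat flat_subset by simp

text \<open>Additivity of the ranks forces \<open>card (I \<union> J)\<close> to be
  \<open>card I + card J\<close>, so I and J are disjoint and their union is a basis of the
  join.\<close>

lemma y_prod_mult:
  assumes "flat_basis E M F I" "flat_basis E M G J" "flat_basis E M (flat_join M F G) K"
    and rank: "matroid_rank M F + matroid_rank M G = matroid_rank M (flat_join M F G)"
  shows "(\<Prod>i\<in>I. y i) * (\<Prod>j\<in>J. y j) - (\<Prod>k\<in>K. y k) \<in> chow_ideal E M"
proof -
  note I = flat_basisD[OF assms(1)] and J = flat_basisD[OF assms(2)]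
  have "card I + card J = rk (I \<union> J)"
    using rank I(6) J(6) rk_join_bases[OF assms(1,2)] by simp
  moreover have "rk (I \<union> J) \<le> card (I \<union> J)" by (rule rk_le_card) (use I J in auto)
  moreover have "card (I \<union> J) + card (I \<inter> J) = card I + card J"
    using card_Un_Int[OF I(7) J(7)] by simp
  ultimately have card: "card (I \<inter> J) = 0" "rk (I \<union> J) = card (I \<union> J)" by linarith+
  then have disj: "I \<inter> J = {}" using I(7) by simp
  have "flat_basis E M (flat_join M F G) (I \<union> J)"
    using card(2) I(4) J(4) rk_join_bases[OF assms(1,2)] by (simp add: flat_basis_def indep_iff)
  from y_prod_basis_cong[OF this assms(3)] show ?thesis
    by (simp add: prod.union_disjoint[OF I(7) J(7) disj])
qed

text \<open>The rank of the join never exceeds the sum of the ranks, so here it is smaller; the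
  multiset sum of I and J then has more members than its rank.\<close>

lemma y_prod_mult_zero:
  assumes "flat_basis E M F I" "flat_basis E M G J"
    and rank: "matroid_rank M F + matroid_rank M G \<noteq> matroid_rank M (flat_join M F G)"
  shows "(\<Prod>i\<in>I. y i) * (\<Prod>j\<in>J. y j) \<in> chow_ideal E M"
proof -
  note I = flat_basisD[OF assms(1)] and J = flat_basisD[OF assms(2)]
  have "rk (I \<union> J) \<le> card (I \<union> J)" by (rule rk_le_card) (use I J in auto)
  also have "\<dots> \<le> card I + card J" by (rule card_Un_le)
  finally have "rk (I \<union> J) < card I + card J"
    using rank I(6) J(6) rk_join_bases[OF assms(1,2)] by simp
  then have "y_mset (mset_set I + mset_set J) \<in> chow_ideal E M"
    by (intro y_mset_dependent) (use I J in auto)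
  then show ?thesis by (simp add: prod_unfold_prod_mset)
qed

end

section \<open>Homogeneous components\<close>

definition monom_degree :: "('v \<Rightarrow>\<^sub>0 nat) \<Rightarrow> nat" where
  "monom_degree m = (\<Sum>v\<in>Poly_Mapping.keys m. Poly_Mapping.lookup m v)"

lemma monom_degree_add: "monom_degree (m + n) = monom_degree m + monom_degree n"
proof -
  let ?A = "Poly_Mapping.keys m \<union> Poly_Mapping.keys n"
  have *: "monom_degree l = (\<Sum>v\<in>?A. Poly_Mapping.lookup l v)" if "Poly_Mapping.keys l \<subseteq> ?A" for l
    unfolding monom_degree_def by (rule sum.mono_neutral_left) (use that in \<open>auto simp: in_keys_iff\<close>)
  show ?thesis
    by (subst (1 2 3) *) (auto simp: lookup_add sum.distrib dest: set_mp[OF keys_add])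
qed

definition mpoly_component :: "nat \<Rightarrow> 'v rat_mpoly \<Rightarrow> 'v rat_mpoly" where
  "mpoly_component k p = Poly_Mapping.mapp (\<lambda>m c. c when monom_degree m = k) p"

lemma lookup_mpoly_component:
  "Poly_Mapping.lookup (mpoly_component k p) m = (Poly_Mapping.lookup p m when monom_degree m = k)"
  by (auto simp: mpoly_component_def lookup_mapp when_def in_keys_iff)

lemma keys_mpoly_component:
  "Poly_Mapping.keys (mpoly_component k p) = {m \<in> Poly_Mapping.keys p. monom_degree m = k}"
  by (auto simp: in_keys_iff lookup_mpoly_component)

lemma mpoly_component_add: "mpoly_component k (p + q) = mpoly_component k p + mpoly_component k q"
  by (rule poly_mapping_eqI) (simp add: lookup_mpoly_component lookup_add when_def)

lemma mpoly_component_zero [simp]: "mpoly_component k 0 = 0"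
  by (rule poly_mapping_eqI) (simp add: lookup_mpoly_component)

lemma mpoly_component_diff: "mpoly_component k (p - q) = mpoly_component k p - mpoly_component k q"
  by (rule poly_mapping_eqI) (simp add: lookup_mpoly_component lookup_minus when_def)

lemma mpoly_component_sum: "mpoly_component k (\<Sum>i\<in>A. f i) = (\<Sum>i\<in>A. mpoly_component k (f i))"
  by (induction A rule: infinite_finite_induct) (simp_all add: mpoly_component_add)

lemma mpoly_component_single:
  "mpoly_component k (Poly_Mapping.single m c) = (if monom_degree m = k then Poly_Mapping.single m c else 0)"
  by (rule poly_mapping_eqI) (auto simp: lookup_mpoly_component lookup_single when_def)

text \<open>A monomial shifts all degrees by its own; the case distinction guards the truncated
  subtraction.\<close>

lemma mpoly_component_single_mult:
  "mpoly_component k (Poly_Mapping.single a c * p) =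
    (if monom_degree a \<le> k then Poly_Mapping.single a c * mpoly_component (k - monom_degree a) p else 0)"
proof (induction p rule: poly_mapping_induct_add)
  case (single m d)
  show ?case by (auto simp: mult_single mpoly_component_single monom_degree_add)
next
  case (add p q)
  then show ?case by (simp add: distrib_left mpoly_component_add)
qed

lemma homogeneous_mpolys_iff:
  "p \<in> homogeneous_mpolys V k \<longleftrightarrow>
    p \<in> carrier (mpoly_ring V) \<and> (\<forall>m\<in>Poly_Mapping.keys p. monom_degree m = k)"
  by (simp add: homogeneous_mpolys_def monom_degree_def)

lemma mpoly_component_homogeneous:
  "p \<in> carrier (mpoly_ring V) \<Longrightarrow> mpoly_component k p \<in> homogeneous_mpolys V k"
  by (auto simp: homogeneous_mpolys_iff keys_mpoly_component mpoly_ring_simps)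

lemma mpoly_component_of_homogeneous:
  assumes "p \<in> homogeneous_mpolys V k"
  shows "mpoly_component j p = (if j = k then p else 0)"
  using assms
  by (intro poly_mapping_eqI)
    (auto simp: lookup_mpoly_component homogeneous_mpolys_iff when_def in_keys_iff)

lemma mpoly_sum_components:
  assumes "finite K" "monom_degree ` Poly_Mapping.keys p \<subseteq> K"
  shows "p = (\<Sum>k\<in>K. mpoly_component k p)"
proof (rule poly_mapping_eqI)
  fix m
  show "Poly_Mapping.lookup p m = Poly_Mapping.lookup (\<Sum>k\<in>K. mpoly_component k p) m"
    using assms
    by (cases "m \<in> Poly_Mapping.keys p")
      (auto simp: lookup_sum lookup_mpoly_component when_def in_keys_iff)
qed

lemma homogeneous_mpolys_carrier: "p \<in> homogeneous_mpolys V k \<Longrightarrow> p \<in> carrier (mpoly_ring V)"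
  by (simp add: homogeneous_mpolys_iff)

lemma homogeneous_mpolys_zero: "0 \<in> homogeneous_mpolys V k"
  and homogeneous_mpolys_const: "mpoly_const c \<in> homogeneous_mpolys V 0"
  and homogeneous_mpolys_one: "1 \<in> homogeneous_mpolys V 0"
  by (auto simp: homogeneous_mpolys_iff monom_degree_def mpoly_const_def
      intro: mpoly_carrier_intros[unfolded mpoly_const_def])

lemma homogeneous_mpolys_var: "v \<in> V \<Longrightarrow> mpoly_var v \<in> homogeneous_mpolys V 1"
  using mpoly_carrier_var[of v V] by (simp add: homogeneous_mpolys_iff monom_degree_def mpoly_var_def)

lemma homogeneous_mpolys_add:
  "p \<in> homogeneous_mpolys V k \<Longrightarrow> q \<in> homogeneous_mpolys V k \<Longrightarrow> p + q \<in> homogeneous_mpolys V k"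
  using keys_add[of p q] by (auto simp: homogeneous_mpolys_iff intro: mpoly_carrier_add)

lemma homogeneous_mpolys_uminus: "p \<in> homogeneous_mpolys V k \<Longrightarrow> - p \<in> homogeneous_mpolys V k"
  by (auto simp: homogeneous_mpolys_iff keys_uminus intro: mpoly_carrier_uminus)

lemma homogeneous_mpolys_diff:
  "p \<in> homogeneous_mpolys V k \<Longrightarrow> q \<in> homogeneous_mpolys V k \<Longrightarrow> p - q \<in> homogeneous_mpolys V k"
  using homogeneous_mpolys_add[of p V k "- q"] homogeneous_mpolys_uminus[of q V k] by simp

lemma homogeneous_mpolys_sum:
  "(\<And>i. i \<in> A \<Longrightarrow> f i \<in> homogeneous_mpolys V k) \<Longrightarrow> (\<Sum>i\<in>A. f i) \<in> homogeneous_mpolys V k"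
  by (induction A rule: infinite_finite_induct) (auto intro: homogeneous_mpolys_zero homogeneous_mpolys_add)

lemma homogeneous_mpolys_mult:
  assumes "p \<in> homogeneous_mpolys V j" "q \<in> homogeneous_mpolys V k"
  shows "p * q \<in> homogeneous_mpolys V (j + k)"
  unfolding homogeneous_mpolys_iff
proof (intro conjI ballI)
  show "p * q \<in> carrier (mpoly_ring V)"
    using assms by (auto simp: homogeneous_mpolys_iff intro: mpoly_carrier_mult)
  fix m assume "m \<in> Poly_Mapping.keys (p * q)"
  then obtain a b where "m = a + b" "a \<in> Poly_Mapping.keys p" "b \<in> Poly_Mapping.keys q"
    using keys_mult[of p q] by blast
  then show "monom_degree m = j + k"
    using assms by (simp add: homogeneous_mpolys_iff monom_degree_add)
qed

section \<open>Homogeneity of the Chow ideal\<close>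

context matroid
begin

lemma y_homogeneous: "i \<in> E \<Longrightarrow> y i \<in> homogeneous_mpolys (chow_vars E M) 1"
  and x_homogeneous: "F \<in> M - {E} \<Longrightarrow> x F \<in> homogeneous_mpolys (chow_vars E M) 1"
  unfolding chow_vars_def by (rule homogeneous_mpolys_var, blast)+

lemma y_prod_homogeneous:
  assumes "finite I" "I \<subseteq> E"
  shows "(\<Prod>i\<in>I. y i) \<in> homogeneous_mpolys (chow_vars E M) (card I)"
  using assms
proof (induction I)
  case (insert i I)
  then show ?case
    using homogeneous_mpolys_mult[OF y_homogeneous[of i], of "\<Prod>i\<in>I. y i" "card I"] by simp
qed (simp add: homogeneous_mpolys_one)

lemma chow_relations_homogeneous:
  assumes "r \<in> chow_relations E M"
  shows "\<exists>k. r \<in> homogeneous_mpolys (chow_vars E M) k"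
proof -
  consider (lin) i where "i \<in> E" "r = y i - (\<Sum>F\<in>{F \<in> M - {E}. i \<notin> F}. x F)"
    | (xx) F G where "F \<in> M - {E}" "G \<in> M - {E}" "r = x F * x G"
    | (yx) i F where "i \<in> E" "F \<in> M - {E}" "r = y i * x F"
    using assms unfolding chow_relations_def by blast
  then show ?thesis
  proof cases
    case lin
    then have "r \<in> homogeneous_mpolys (chow_vars E M) 1"
      unfolding lin(2)
      by (intro homogeneous_mpolys_diff homogeneous_mpolys_sum y_homogeneous x_homogeneous) (use lin(1) in auto)
    then show ?thesis by blast
  next
    case xx
    then show ?thesis using homogeneous_mpolys_mult x_homogeneous by blast
  next
    case yx
    then show ?thesis using homogeneous_mpolys_mult x_homogeneous y_homogeneous by blast
  qed
qed

text \<open>The polynomials with all components in the Chow ideal form an ideal themselves, and it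
  contains the homogeneous generators.\<close>

lemma chow_ideal_component:
  assumes "p \<in> chow_ideal E M"
  shows "mpoly_component k p \<in> chow_ideal E M"
proof -
  let ?J = "{p \<in> chow_polys. \<forall>k. mpoly_component k p \<in> chow_ideal E M}"
  have "ideal ?J (mpoly_ring (chow_vars E M))"
  proof (rule mpoly_idealI)
    fix q p assume q: "q \<in> chow_polys" and p: "p \<in> ?J"
    have single: "Poly_Mapping.single a c \<in> chow_polys" if "a \<in> Poly_Mapping.keys q" for a c
      using that q by (auto simp: mpoly_ring_simps)
    have "mpoly_component k (q * p) \<in> chow_ideal E M" for k
    proof -
      have "q * p = (\<Sum>a\<in>Poly_Mapping.keys q. Poly_Mapping.single a (Poly_Mapping.lookup q a) * p)"
        by (subst poly_mapping_sum_single[of q]) (rule sum_distrib_right)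
      then have "mpoly_component k (q * p) = (\<Sum>a\<in>Poly_Mapping.keys q.
          if monom_degree a \<le> k then Poly_Mapping.single a (Poly_Mapping.lookup q a) *
            mpoly_component (k - monom_degree a) p else 0)"
        by (simp add: mpoly_component_sum mpoly_component_single_mult)
      also have "\<dots> \<in> chow_ideal E M"
        using p single by (intro chow_ideal_sum) (auto intro: chow_ideal_mult chow_ideal_zero)
      finally show ?thesis .
    qed
    then show "q * p \<in> ?J" using q p mpoly_carrier_mult by blast
  qed (auto simp: mpoly_component_add chow_ideal_zero intro: mpoly_carrier_zero mpoly_carrier_add chow_ideal_add)
  moreover have "chow_relations E M \<subseteq> ?J"
  proof
    fix r assume r: "r \<in> chow_relations E M"
    obtain k where "r \<in> homogeneous_mpolys (chow_vars E M) k"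
      using chow_relations_homogeneous[OF r] by blast
    then show "r \<in> ?J"
      using r chow_relations_in_ideal chow_relations_carrier
      by (auto simp: mpoly_component_of_homogeneous chow_ideal_zero)
  qed
  ultimately show ?thesis using chow_ideal_minimal assms by blast
qed

end

section \<open>The augmented Chow ring as a graded algebra\<close>

text \<open>Closure under negation comes from closure under scalars, since negation is
  multiplication by the negative of the unit.\<close>

lemma (in module) submoduleI_smult:
  assumes "H \<subseteq> carrier M" "\<zero>\<^bsub>M\<^esub> \<in> H"
    and "\<And>a b. a \<in> H \<Longrightarrow> b \<in> H \<Longrightarrow> a \<oplus>\<^bsub>M\<^esub> b \<in> H"
    and smult: "\<And>a x. a \<in> carrier R \<Longrightarrow> x \<in> H \<Longrightarrow> a \<odot>\<^bsub>M\<^esub> x \<in> H"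
  shows "submodule H R M"
proof (rule submoduleI)
  fix a assume a: "a \<in> H"
  have "\<ominus>\<^bsub>M\<^esub> a = (\<ominus> \<one>) \<odot>\<^bsub>M\<^esub> a"
    using smult_l_minus[of \<one> a] smult_one[of a] a assms(1) by auto
  then show "\<ominus>\<^bsub>M\<^esub> a \<in> H" using smult a by simp
qed (use assms in auto)

lemma rat_ring_simps:
  "carrier rat_ring = UNIV" "a \<otimes>\<^bsub>rat_ring\<^esub> b = a * b" "a \<oplus>\<^bsub>rat_ring\<^esub> b = a + b"
  "\<one>\<^bsub>rat_ring\<^esub> = 1" "\<zero>\<^bsub>rat_ring\<^esub> = 0"
  by (simp_all add: ring_of_type_algebra_def)

context matroid
begin

abbreviation CH :: "(rat, 'a chow_var rat_mpoly set) module" where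
  "CH \<equiv> augmented_chow E M"

abbreviation cc :: "'a chow_var rat_mpoly \<Rightarrow> 'a chow_var rat_mpoly set" where
  "cc \<equiv> chow_class E M"

text \<open>The coset of p consists of the r with \<open>r - p\<close> in the ideal. This turns
  equations in the quotient into membership statements.\<close>

lemma cc_eq_iff: "cc p = cc q \<longleftrightarrow> p - q \<in> chow_ideal E M"
proof -
  have cc: "r \<in> cc p \<longleftrightarrow> r - p \<in> chow_ideal E M" for r p
    by (auto simp: chow_class_def chow_poly_ring_def a_r_coset_def' mpoly_ring_simps
        intro: bexI[of _ "r - p"])
  show ?thesis
  proof
    assume "cc p = cc q"
    then show "p - q \<in> chow_ideal E M" using cc[of p p] cc[of p q] by (simp add: chow_ideal_zero)
  next
    assume pq: "p - q \<in> chow_ideal E M"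
    have "r - p \<in> chow_ideal E M \<longleftrightarrow> r - q \<in> chow_ideal E M" for r
      using chow_ideal_add[OF _ pq, of "r - p"] chow_ideal_diff[OF _ pq, of "r - q"] by auto
    then show "cc p = cc q" using cc by blast
  qed
qed

lemma CH_carrier: "carrier CH = cc ` chow_polys"
  by (auto simp: augmented_chow_def Let_def FactRing_def A_RCOSETS_def' chow_class_def chow_poly_ring_def)

lemma cc_carrier: "p \<in> chow_polys \<Longrightarrow> cc p \<in> carrier CH"
  by (simp add: CH_carrier)

lemma CH_mult: "p \<in> chow_polys \<Longrightarrow> q \<in> chow_polys \<Longrightarrow> cc p \<otimes>\<^bsub>CH\<^esub> cc q = cc (p * q)"
  using ideal.rcoset_mult_add[OF ideal_chow_ideal, of p q]
  by (simp add: augmented_chow_def Let_def FactRing_def chow_class_def chow_poly_ring_def mpoly_ring_simps(2-))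

lemma CH_add: "p \<in> chow_polys \<Longrightarrow> q \<in> chow_polys \<Longrightarrow> cc p \<oplus>\<^bsub>CH\<^esub> cc q = cc (p + q)"
  using ring_hom_add[OF ideal.rcos_ring_hom[OF ideal_chow_ideal], of p q]
  by (simp add: augmented_chow_def Let_def FactRing_def chow_class_def chow_poly_ring_def mpoly_ring_simps(2-))

lemma CH_one: "\<one>\<^bsub>CH\<^esub> = cc 1"
  by (simp add: augmented_chow_def Let_def FactRing_def chow_class_def chow_poly_ring_def mpoly_ring_simps(2-))

lemma CH_zero: "\<zero>\<^bsub>CH\<^esub> = cc 0"
  using chow_ideal_zero
  by (auto simp: augmented_chow_def Let_def FactRing_def chow_class_def chow_poly_ring_def a_r_coset_def'
      mpoly_ring_simps(2-))

lemma CH_smult: "p \<in> chow_polys \<Longrightarrow> c \<odot>\<^bsub>CH\<^esub> cc p = cc (mpoly_const c * p)"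
  using CH_mult[OF mpoly_carrier_const, of p c] by (simp add: augmented_chow_def Let_def)

lemmas CH_simps = CH_mult CH_add CH_one CH_zero CH_smult mpoly_carrier_intros

lemma mpoly_const_add: "mpoly_const (a + b) = mpoly_const a + mpoly_const b"
  and mpoly_const_mult: "mpoly_const (a * b) = mpoly_const a * mpoly_const b"
  and mpoly_const_one: "mpoly_const 1 = 1"
  by (simp_all add: mpoly_const_def single_add mult_single)

lemma cring_CH: "cring CH"
proof (rule cringI)
  show "abelian_group CH"
  proof (rule abelian_groupI)
    fix u assume "u \<in> carrier CH"
    then obtain p where p: "u = cc p" "p \<in> chow_polys" by (auto simp: CH_carrier)
    then have "cc (- p) \<oplus>\<^bsub>CH\<^esub> u = \<zero>\<^bsub>CH\<^esub>" by (simp add: CH_simps)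
    then show "\<exists>v\<in>carrier CH. v \<oplus>\<^bsub>CH\<^esub> u = \<zero>\<^bsub>CH\<^esub>"
      using p mpoly_carrier_uminus cc_carrier by blast
  qed (auto simp: CH_carrier CH_simps add_ac)
  show "Group.comm_monoid CH"
    by (rule comm_monoidI) (auto simp: CH_carrier CH_simps mult_ac)
qed (auto simp: CH_carrier CH_simps distrib_right)

lemma algebra_CH: "algebra rat_ring CH"
proof (rule algebraI[OF cring_from_type_algebra cring_CH])
qed (auto simp: CH_carrier CH_simps rat_ring_simps mpoly_const_add mpoly_const_mult mpoly_const_one
    distrib_right distrib_left mult_ac)

lemma CH_finsum:
  assumes "\<And>i. i \<in> A \<Longrightarrow> c i = cc (q i)" "\<And>i. i \<in> A \<Longrightarrow> q i \<in> chow_polys"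
  shows "finsum CH c A = cc (\<Sum>i\<in>A. q i)"
proof -
  interpret cring CH by (rule cring_CH)
  show ?thesis using assms
  proof (induction A rule: infinite_finite_induct)
    case (insert i A)
    then have "finsum CH c (insert i A) = c i \<oplus>\<^bsub>CH\<^esub> finsum CH c A"
      by (intro finsum_insert) (auto simp: CH_carrier)
    then show ?case using insert by (simp add: CH_simps)
  \<comment> \<open>For infinite A both sums default to zero.\<close>
  qed (simp_all add: CH_zero finsum_infinite)
qed

lemma CH_finprod:
  assumes "\<And>i. i \<in> A \<Longrightarrow> q i \<in> chow_polys" "finite A"
  shows "finprod CH (\<lambda>i. cc (q i)) A = cc (\<Prod>i\<in>A. q i)"
proof -
  interpret cring CH by (rule cring_CH)
  show ?thesis using assms(2,1)
  proof (induction A)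
    case (insert i A)
    then have "finprod CH (\<lambda>i. cc (q i)) (insert i A) = cc (q i) \<otimes>\<^bsub>CH\<^esub> finprod CH (\<lambda>i. cc (q i)) A"
      by (intro finprod_insert) (auto simp: CH_carrier)
    then show ?case using insert by (simp add: CH_simps)
  qed (simp add: CH_one)
qed

section \<open>The grading of the augmented Chow ring\<close>

abbreviation CH_gr :: "nat \<Rightarrow> 'a chow_var rat_mpoly set set" where
  "CH_gr \<equiv> augmented_chow_gr E M"

lemma CH_gr_iff: "u \<in> CH_gr k \<longleftrightarrow> (\<exists>p\<in>homogeneous_mpolys (chow_vars E M) k. u = cc p)"
  by (auto simp: augmented_chow_gr_def)

text \<open>Existence comes from the homogeneous components of a representative, uniqueness from the
  homogeneity of the ideal.\<close>

lemma CH_gr_direct_sum: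
  assumes "u \<in> carrier CH"
  shows "\<exists>!c. (\<forall>k. c k \<in> CH_gr k) \<and> finite {k. c k \<noteq> \<zero>\<^bsub>CH\<^esub>} \<and>
           u = finsum CH c {k. c k \<noteq> \<zero>\<^bsub>CH\<^esub>}"
proof -
  obtain p where p: "p \<in> chow_polys" "u = cc p" using assms by (auto simp: CH_carrier)
  let ?c = "\<lambda>k. cc (mpoly_component k p)"
  have hom: "mpoly_component k p \<in> homogeneous_mpolys (chow_vars E M) k" for k
    by (rule mpoly_component_homogeneous[OF p(1)])
  show ?thesis
  proof (rule ex1I[of _ ?c])
    let ?D = "monom_degree ` Poly_Mapping.keys p" and ?K = "{k. ?c k \<noteq> \<zero>\<^bsub>CH\<^esub>}"
    have K: "?K \<subseteq> ?D"
    proof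
      fix k assume "k \<in> ?K"
      then have "mpoly_component k p \<noteq> 0" by (auto simp: CH_zero)
      then have "Poly_Mapping.keys (mpoly_component k p) \<noteq> {}" by (simp add: poly_mapping_eq_iff fun_eq_iff in_keys_iff flip: ex_in_conv)
      then show "k \<in> ?D" by (auto simp: keys_mpoly_component)
    qed
    then have finK: "finite ?K" by (rule finite_subset) simp
    \<comment> \<open>Components with zero class are absent from the finite sum; they lie in the
      ideal, so dropping them keeps the class of p.\<close>
    have "p - (\<Sum>k\<in>?K. mpoly_component k p) = (\<Sum>k\<in>?D - ?K. mpoly_component k p)"
      using mpoly_sum_components[of ?D p] K by (simp add: sum_diff)
    also have "\<dots> \<in> chow_ideal E M"
      by (rule chow_ideal_sum) (auto simp: CH_zero cc_eq_iff)
    finally have "u = cc (\<Sum>k\<in>?K. mpoly_component k p)" using p by (simp add: cc_eq_iff)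
    also have "\<dots> = finsum CH ?c ?K"
      by (rule CH_finsum[symmetric]) (use hom homogeneous_mpolys_carrier in auto)
    finally show "(\<forall>k. ?c k \<in> CH_gr k) \<and> finite ?K \<and> u = finsum CH ?c ?K"
      using hom finK by (auto simp: CH_gr_iff)
  next
    fix c assume c: "(\<forall>k. c k \<in> CH_gr k) \<and> finite {k. c k \<noteq> \<zero>\<^bsub>CH\<^esub>} \<and>
      u = finsum CH c {k. c k \<noteq> \<zero>\<^bsub>CH\<^esub>}"
    let ?K = "{k. c k \<noteq> \<zero>\<^bsub>CH\<^esub>}"
    have "\<forall>k. \<exists>q. q \<in> homogeneous_mpolys (chow_vars E M) k \<and> c k = cc q"
      using c by (auto simp: CH_gr_iff)
    then obtain q where q: "\<And>k. q k \<in> homogeneous_mpolys (chow_vars E M) k" "\<And>k. c k = cc (q k)"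
      by metis
    have "u = cc (\<Sum>k\<in>?K. q k)"
      using c CH_finsum[of ?K c q] q homogeneous_mpolys_carrier by metis
    then have diff: "p - (\<Sum>k\<in>?K. q k) \<in> chow_ideal E M"
      using p by (simp add: cc_eq_iff)
    show "c = ?c"
    proof
      fix j
      \<comment> \<open>The part of degree j of the difference stays in the ideal, which determines
        the class \<open>c j\<close>.\<close>
      have "mpoly_component j p - (\<Sum>k\<in>?K. if j = k then q k else 0) \<in> chow_ideal E M"
        using chow_ideal_component[OF diff, of j] mpoly_component_of_homogeneous[OF q(1)]
        by (simp add: mpoly_component_diff mpoly_component_sum)
      then have "?c j = cc (if j \<in> ?K then q j else 0)"
        using c by (simp add: cc_eq_iff)
      then show "c j = ?c j" using q(2) by (auto simp: CH_zero split: if_splits)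
    qed
  qed
qed

lemma graded_algebra_CH: "graded_algebra rat_ring CH CH_gr"
proof (intro graded_algebra.intro graded_algebra_axioms.intro)
  show "algebra rat_ring CH" by (rule algebra_CH)
  interpret algebra rat_ring CH by (rule algebra_CH)
  show "submodule (CH_gr k) rat_ring CH" for k
  proof (rule submoduleI_smult)
    show "CH_gr k \<subseteq> carrier CH"
      unfolding augmented_chow_gr_def using cc_carrier homogeneous_mpolys_carrier by blast
    show "\<zero>\<^bsub>CH\<^esub> \<in> CH_gr k"
      using homogeneous_mpolys_zero by (auto simp: CH_gr_iff CH_zero)
    show "u \<oplus>\<^bsub>CH\<^esub> v \<in> CH_gr k" if "u \<in> CH_gr k" "v \<in> CH_gr k" for u v
      using that homogeneous_mpolys_add homogeneous_mpolys_carrier CH_add unfolding CH_gr_iff by metis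
    show "a \<odot>\<^bsub>CH\<^esub> u \<in> CH_gr k" if "u \<in> CH_gr k" for a u
      using that homogeneous_mpolys_mult[OF homogeneous_mpolys_const[of a]] homogeneous_mpolys_carrier CH_smult
      unfolding CH_gr_iff by (metis add_0)
  qed
  show "\<one>\<^bsub>CH\<^esub> \<in> CH_gr 0"
    using homogeneous_mpolys_one by (auto simp: CH_gr_iff CH_one)
  show "u \<otimes>\<^bsub>CH\<^esub> v \<in> CH_gr (i + j)" if "u \<in> CH_gr i" "v \<in> CH_gr j" for u v i j
    using that homogeneous_mpolys_mult homogeneous_mpolys_carrier CH_mult unfolding CH_gr_iff by metis
qed (rule CH_gr_direct_sum)

lemma chow_y_eq:
  assumes "flat_basis E M F I"
  shows "chow_y E M F = cc (\<Prod>i\<in>I. y i)"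
proof -
  have prod: "finprod CH (\<lambda>i. cc (y i)) J = cc (\<Prod>i\<in>J. y i)" if "flat_basis E M F J" for J
    using flat_basisD(4,7)[OF that] by (intro CH_finprod) (auto intro: y_carrier)
  show ?thesis
    unfolding chow_y_def
  proof (rule the_equality)
    show "\<exists>J. flat_basis E M F J \<and> cc (\<Prod>i\<in>I. y i) = finprod CH (\<lambda>i. cc (y i)) J"
      using prod assms by auto
    show "u = cc (\<Prod>i\<in>I. y i)"
      if "\<exists>J. flat_basis E M F J \<and> u = finprod CH (\<lambda>i. cc (y i)) J" for u
    proof -
      from that obtain J where J: "flat_basis E M F J" "u = finprod CH (\<lambda>i. cc (y i)) J" by blast
      then show ?thesis using prod[OF J(1)] y_prod_basis_cong[OF J(1) assms] by (simp add: cc_eq_iff)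
    qed
  qed
qed

end

section \<open>The graded Moebius algebra inside the augmented Chow ring\<close>

lemma keys_sum_subset:
  fixes f :: "'i \<Rightarrow> 'k \<Rightarrow>\<^sub>0 'b::comm_monoid_add"
  assumes "\<And>i. i \<in> A \<Longrightarrow> Poly_Mapping.keys (f i) \<subseteq> N"
  shows "Poly_Mapping.keys (\<Sum>i\<in>A. f i) \<subseteq> N"
proof
  fix k assume "k \<in> Poly_Mapping.keys (\<Sum>i\<in>A. f i)"
  then have "(\<Sum>i\<in>A. Poly_Mapping.lookup (f i) k) \<noteq> 0" by (simp add: in_keys_iff lookup_sum)
  then obtain i where "i \<in> A" "Poly_Mapping.lookup (f i) k \<noteq> 0" by (meson sum.neutral)
  then have "k \<in> Poly_Mapping.keys (f i)" by (simp add: in_keys_iff)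
  then show "k \<in> N" using assms \<open>i \<in> A\<close> by blast
qed

lemma lookup_map_times:
  "Poly_Mapping.lookup (Poly_Mapping.map ((*) c) f) k = (c::'b::mult_zero) * Poly_Mapping.lookup f k"
  by (simp add: Poly_Mapping.map.rep_eq when_def)

lemma keys_map_times: "Poly_Mapping.keys (Poly_Mapping.map ((*) (c::rat)) f) \<subseteq> Poly_Mapping.keys f"
  by (auto simp: in_keys_iff lookup_map_times)

lemma graded_moebius_simps:
  "carrier (graded_moebius M) = {f. Poly_Mapping.keys f \<subseteq> M}"
  "f \<otimes>\<^bsub>graded_moebius M\<^esub> g = moebius_mult M f g" "f \<oplus>\<^bsub>graded_moebius M\<^esub> g = f + g"
  "\<one>\<^bsub>graded_moebius M\<^esub> = Poly_Mapping.single (matroid_closure M {}) 1"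
  "\<zero>\<^bsub>graded_moebius M\<^esub> = 0" "c \<odot>\<^bsub>graded_moebius M\<^esub> f = Poly_Mapping.map ((*) c) f"
  by (simp_all add: graded_moebius_def)

context matroid
begin

abbreviation HM :: "(rat, 'a set \<Rightarrow>\<^sub>0 rat) module" where
  "HM \<equiv> graded_moebius M"

abbreviation HM_gr :: "nat \<Rightarrow> ('a set \<Rightarrow>\<^sub>0 rat) set" where
  "HM_gr \<equiv> graded_moebius_gr M"

abbreviation \<phi> :: "('a set \<Rightarrow>\<^sub>0 rat) \<Rightarrow> 'a chow_var rat_mpoly set" where
  "\<phi> \<equiv> moebius_to_chow E M"

definition chosen_basis :: "'a set \<Rightarrow> 'a set" where
  "chosen_basis F = (SOME I. flat_basis E M F I)"

lemma chosen_basis: "F \<in> M \<Longrightarrow> flat_basis E M F (chosen_basis F)"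
  unfolding chosen_basis_def using basis_exists someI_ex[of "flat_basis E M F"] by blast

abbreviation y_flat :: "'a set \<Rightarrow> 'a chow_var rat_mpoly" where
  "y_flat F \<equiv> \<Prod>i\<in>chosen_basis F. y i"

lemma y_flat_carrier: "F \<in> M \<Longrightarrow> y_flat F \<in> chow_polys"
  using chosen_basis flat_basisD(4) y_prod_carrier by blast

text \<open>A polynomial representative of the image of f, by which statements about
  \<open>\<phi>\<close> become statements about the Chow ideal.\<close>

definition lift :: "('a set \<Rightarrow>\<^sub>0 rat) \<Rightarrow> 'a chow_var rat_mpoly" where
  "lift = const.lin_ext y_flat"

lemma lift_eq: "lift f = (\<Sum>F\<in>Poly_Mapping.keys f. mpoly_const (Poly_Mapping.lookup f F) * y_flat F)"
  by (simp add: lift_def const.lin_ext_def mpoly_const_def)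

lemma lift_single: "lift (Poly_Mapping.single F c) = mpoly_const c * y_flat F"
  by (simp add: lift_def mpoly_const_def)

lemma lift_carrier: "f \<in> carrier HM \<Longrightarrow> lift f \<in> chow_polys"
  unfolding lift_eq graded_moebius_simps
  by (intro mpoly_carrier_sum mpoly_carrier_mult mpoly_carrier_const y_flat_carrier) auto

lemma moebius_to_chow_eq:
  assumes "f \<in> carrier HM"
  shows "\<phi> f = cc (lift f)"
  unfolding moebius_to_chow_def lift_eq
proof (rule CH_finsum)
  fix F assume "F \<in> Poly_Mapping.keys f"
  then have F: "F \<in> M" using assms by (auto simp: graded_moebius_simps)
  show "Poly_Mapping.lookup f F \<odot>\<^bsub>CH\<^esub> chow_y E M F = cc (mpoly_const (Poly_Mapping.lookup f F) * y_flat F)"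
    by (simp add: chow_y_eq[OF chosen_basis[OF F]] CH_smult y_flat_carrier[OF F])
  show "mpoly_const (Poly_Mapping.lookup f F) * y_flat F \<in> chow_polys"
    by (intro mpoly_carrier_mult mpoly_carrier_const y_flat_carrier F)
qed

section \<open>Closure properties and compatibility with the linear map\<close>

lemma HM_add_closed: "f \<in> carrier HM \<Longrightarrow> g \<in> carrier HM \<Longrightarrow> f + g \<in> carrier HM"
  using keys_add[of f g] by (auto simp: graded_moebius_simps)

lemma HM_uminus_closed: "f \<in> carrier HM \<Longrightarrow> - f \<in> carrier HM"
  by (simp add: graded_moebius_simps keys_uminus)

lemma HM_smult_closed: "f \<in> carrier HM \<Longrightarrow> Poly_Mapping.map ((*) c) f \<in> carrier HM"
  using keys_map_times[of c f] by (auto simp: graded_moebius_simps)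

lemma HM_mult_closed:
  assumes "f \<in> carrier HM" "g \<in> carrier HM"
  shows "moebius_mult M f g \<in> carrier HM"
  unfolding graded_moebius_simps moebius_mult_def mem_Collect_eq
proof (intro keys_sum_subset)
  fix F G assume "F \<in> Poly_Mapping.keys f" "G \<in> Poly_Mapping.keys g"
  then have "flat_join M F G \<in> M"
    using assms flat_join_flat unfolding graded_moebius_simps by blast
  then show "Poly_Mapping.keys (if matroid_rank M F + matroid_rank M G = matroid_rank M (flat_join M F G)
      then Poly_Mapping.single (flat_join M F G) (Poly_Mapping.lookup f F * Poly_Mapping.lookup g G)
      else 0) \<subseteq> M"
    by simp
qed

lemma HM_one_closed: "Poly_Mapping.single (cl {}) 1 \<in> carrier HM"
  by (simp add: graded_moebius_simps cl_flat)

text \<open>If f and g have the same image, \<open>f - g\<close> lifts into the ideal, and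
  independence of the basis products kills its coefficients.\<close>

lemma moebius_to_chow_inj: "inj_on \<phi> (carrier HM)"
proof (rule inj_onI)
  fix f g assume fg: "f \<in> carrier HM" "g \<in> carrier HM" "\<phi> f = \<phi> g"
  have d: "f - g \<in> carrier HM"
    using HM_add_closed[OF fg(1) HM_uminus_closed[OF fg(2)]] by simp
  have "lift (f - g) \<in> chow_ideal E M"
    using fg by (simp add: moebius_to_chow_eq cc_eq_iff lift_def const.lin_ext_diff)
  then have "Poly_Mapping.lookup (f - g) F = 0" if "F \<in> Poly_Mapping.keys (f - g)" for F
    using d that unfolding lift_eq
    by (intro basis_products_independent[where B = chosen_basis and N = "Poly_Mapping.keys (f - g)"])
      (auto simp: graded_moebius_simps intro: chosen_basis)
  then have "Poly_Mapping.lookup (f - g) F = 0" for F by (auto simp: in_keys_iff)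
  then have "f - g = 0" by (intro poly_mapping_eqI) simp
  then show "f = g" by simp
qed

lemma moebius_to_chow_add:
  "f \<in> carrier HM \<Longrightarrow> g \<in> carrier HM \<Longrightarrow> \<phi> (f + g) = \<phi> f \<oplus>\<^bsub>CH\<^esub> \<phi> g"
  by (simp add: moebius_to_chow_eq HM_add_closed CH_add lift_carrier) (simp add: lift_def const.lin_ext_add)

lemma lift_smult: "lift (Poly_Mapping.map ((*) c) f) = mpoly_const c * lift f"
  unfolding lift_def
  \<comment> \<open>For c = 0 the scaled mapping has no keys, so both sides are summed over the keys
    of f.\<close>
  by (subst (1 2) const.lin_ext_superset[of "Poly_Mapping.keys f"])
    (simp_all add: keys_map_times lookup_map_times sum_distrib_left const.hom_mult mpoly_const_def mult.assoc)

lemma moebius_to_chow_smult: "f \<in> carrier HM \<Longrightarrow> \<phi> (Poly_Mapping.map ((*) c) f) = c \<odot>\<^bsub>CH\<^esub> \<phi> f"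
  by (simp add: moebius_to_chow_eq HM_smult_closed CH_smult lift_carrier lift_smult)

text \<open>Both sides expand bilinearly, so the pairs of flats are compared one by one modulo the
  ideal: either the ranks add up, or both products vanish.\<close>

lemma moebius_to_chow_mult:
  assumes f: "f \<in> carrier HM" and g: "g \<in> carrier HM"
  shows "\<phi> (moebius_mult M f g) = \<phi> f \<otimes>\<^bsub>CH\<^esub> \<phi> g"
proof -
  let ?a = "Poly_Mapping.lookup f" and ?b = "Poly_Mapping.lookup g"
  let ?r = "\<lambda>F G. matroid_rank M F + matroid_rank M G = matroid_rank M (flat_join M F G)"
  let ?t = "\<lambda>F G. if ?r F G then Poly_Mapping.single (flat_join M F G) (?a F * ?b G) else 0"
  have summand: "lift (?t F G) - (mpoly_const (?a F) * y_flat F) * (mpoly_const (?b G) * y_flat G) \<in> chow_ideal E M"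
    if FG: "F \<in> Poly_Mapping.keys f" "G \<in> Poly_Mapping.keys g" for F G
  proof -
    have M: "F \<in> M" "G \<in> M" using FG f g by (auto simp: graded_moebius_simps)
    note bases = chosen_basis[OF M(1)] chosen_basis[OF M(2)]
    let ?c = "mpoly_const (?a F * ?b G) :: 'a chow_var rat_mpoly"
    have prod: "(mpoly_const (?a F) * y_flat F) * (mpoly_const (?b G) * y_flat G) = ?c * (y_flat F * y_flat G)"
      by (simp add: mpoly_const_mult mult_ac)
    show ?thesis
    proof (cases "?r F G")
      case True
      have "- (?c * (y_flat F * y_flat G - y_flat (flat_join M F G))) \<in> chow_ideal E M"
        using y_prod_mult[OF bases chosen_basis[OF flat_join_flat[OF M]] True]
        by (intro chow_ideal_uminus chow_ideal_mult mpoly_carrier_const)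
      then show ?thesis unfolding prod using True by (simp add: lift_single right_diff_distrib)
    next
      case False
      have "- (?c * (y_flat F * y_flat G)) \<in> chow_ideal E M"
        by (rule chow_ideal_uminus[OF chow_ideal_mult[OF mpoly_carrier_const y_prod_mult_zero[OF bases False]]])
      then show ?thesis unfolding prod using False by (simp add: lift_def)
    qed
  qed
  have "lift (moebius_mult M f g) - lift f * lift g =
      (\<Sum>F\<in>Poly_Mapping.keys f. \<Sum>G\<in>Poly_Mapping.keys g.
        lift (?t F G) - (mpoly_const (?a F) * y_flat F) * (mpoly_const (?b G) * y_flat G))"
    unfolding moebius_mult_def lift_eq[of f] lift_eq[of g] sum_product sum_subtractf
    by (simp only: lift_def const.lin_ext_sum)
  also have "\<dots> \<in> chow_ideal E M"
    by (intro chow_ideal_sum summand)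
  finally show ?thesis
    using assms by (simp add: moebius_to_chow_eq HM_mult_closed CH_mult lift_carrier cc_eq_iff)
qed

lemma moebius_to_chow_one: "\<phi> (Poly_Mapping.single (cl {}) 1) = \<one>\<^bsub>CH\<^esub>"
proof -
  have "cl {} \<in> M" by (rule cl_flat) simp
  \<comment> \<open>The least flat has rank 0, so its basis is empty and its representative is the
    empty product.\<close>
  from flat_basisD(6,7)[OF chosen_basis[OF this]] have "chosen_basis (cl {}) = {}" by simp
  then show ?thesis
    by (simp add: moebius_to_chow_eq HM_one_closed lift_single CH_one mpoly_const_one)
qed

lemma moebius_to_chow_carrier: "f \<in> carrier HM \<Longrightarrow> \<phi> f \<in> carrier CH"
  by (simp add: moebius_to_chow_eq cc_carrier lift_carrier)

lemma HM_eqI: "f \<in> carrier HM \<Longrightarrow> g \<in> carrier HM \<Longrightarrow> \<phi> f = \<phi> g \<Longrightarrow> f = g"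
  using moebius_to_chow_inj by (auto dest: inj_onD)

text \<open>The multiplicative laws are inherited from the Chow ring along the injection.\<close>

lemma algebra_HM: "algebra rat_ring HM"
proof (rule algebraI[OF cring_from_type_algebra])
  interpret CH: algebra rat_ring CH by (rule algebra_CH)
  note phi = moebius_to_chow_add moebius_to_chow_mult moebius_to_chow_smult moebius_to_chow_one
    moebius_to_chow_carrier
  note closed = HM_add_closed HM_mult_closed HM_smult_closed HM_one_closed
  show "cring HM"
  proof (rule cringI)
    show "abelian_group HM"
    proof (rule abelian_groupI)
      fix f assume "f \<in> carrier HM"
      then show "\<exists>g\<in>carrier HM. g \<oplus>\<^bsub>HM\<^esub> f = \<zero>\<^bsub>HM\<^esub>"
        by (intro bexI[of _ "- f"] HM_uminus_closed) (simp_all add: graded_moebius_simps(2-))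
    qed (use HM_add_closed in \<open>auto simp: graded_moebius_simps(2-) add_ac\<close>, simp add: graded_moebius_simps)
    show "Group.comm_monoid HM"
    proof (rule comm_monoidI)
      fix f g k assume "f \<in> carrier HM" "g \<in> carrier HM" "k \<in> carrier HM"
      then show "f \<otimes>\<^bsub>HM\<^esub> g \<otimes>\<^bsub>HM\<^esub> k = f \<otimes>\<^bsub>HM\<^esub> (g \<otimes>\<^bsub>HM\<^esub> k)"
        unfolding graded_moebius_simps(2-) by (intro HM_eqI) (simp_all add: closed phi CH.m_assoc)
    next
      fix f g assume "f \<in> carrier HM" "g \<in> carrier HM"
      then show "f \<otimes>\<^bsub>HM\<^esub> g = g \<otimes>\<^bsub>HM\<^esub> f"
        unfolding graded_moebius_simps(2-) by (intro HM_eqI) (simp_all add: closed phi CH.m_comm)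
    next
      fix f assume "f \<in> carrier HM"
      then show "\<one>\<^bsub>HM\<^esub> \<otimes>\<^bsub>HM\<^esub> f = f"
        unfolding graded_moebius_simps(2-) by (intro HM_eqI) (simp_all add: closed phi)
    qed (simp_all add: closed graded_moebius_simps(2-))
    fix f g k assume "f \<in> carrier HM" "g \<in> carrier HM" "k \<in> carrier HM"
    then show "(f \<oplus>\<^bsub>HM\<^esub> g) \<otimes>\<^bsub>HM\<^esub> k = f \<otimes>\<^bsub>HM\<^esub> k \<oplus>\<^bsub>HM\<^esub> g \<otimes>\<^bsub>HM\<^esub> k"
      unfolding graded_moebius_simps(2-) by (intro HM_eqI) (simp_all add: closed phi CH.l_distr)
  qed
  show "a \<odot>\<^bsub>HM\<^esub> f \<otimes>\<^bsub>HM\<^esub> g = a \<odot>\<^bsub>HM\<^esub> (f \<otimes>\<^bsub>HM\<^esub> g)"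
    if "f \<in> carrier HM" "g \<in> carrier HM" for a f g
    using that CH.smult_assoc2[of a "\<phi> f" "\<phi> g"]
    unfolding graded_moebius_simps(2-)
    by (intro HM_eqI) (simp_all add: closed phi rat_ring_simps)
qed (auto simp: graded_moebius_simps(2-) rat_ring_simps HM_smult_closed lookup_map_times lookup_add
    algebra_simps intro!: poly_mapping_eqI)

section \<open>The grading of the Moebius algebra\<close>

lemma HM_finsum:
  assumes "\<And>i. i \<in> A \<Longrightarrow> c i \<in> carrier HM"
  shows "finsum HM c A = (\<Sum>i\<in>A. c i)"
proof -
  interpret algebra rat_ring HM by (rule algebra_HM)
  show ?thesis using assms
  proof (induction A rule: infinite_finite_induct)
    case (insert i A)
    then have "finsum HM c (insert i A) = c i \<oplus>\<^bsub>HM\<^esub> finsum HM c A"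
      by (intro M.finsum_insert) auto
    then show ?case using insert by (simp add: graded_moebius_simps)
  qed (simp_all add: graded_moebius_simps(5) M.finsum_infinite)
qed

text \<open>The component of degree k keeps the coefficients at flats of rank k. Uniqueness holds
  because a coefficient at F can come only from the component whose degree is the rank of F.\<close>

lemma HM_gr_direct_sum:
  assumes "f \<in> carrier HM"
  shows "\<exists>!c. (\<forall>k. c k \<in> HM_gr k) \<and> finite {k. c k \<noteq> \<zero>\<^bsub>HM\<^esub>} \<and>
           f = finsum HM c {k. c k \<noteq> \<zero>\<^bsub>HM\<^esub>}"
proof -
  define r where "r k = Poly_Mapping.mapp (\<lambda>F a. a when matroid_rank M F = k) f" for k
  have r: "Poly_Mapping.lookup (r k) F = (Poly_Mapping.lookup f F when matroid_rank M F = k)" for k F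
    by (auto simp: r_def lookup_mapp when_def in_keys_iff)
  have gr_carrier: "u \<in> carrier HM" if "u \<in> HM_gr k" for u k
    using that by (auto simp: graded_moebius_simps graded_moebius_gr_def)
  have r_gr: "r k \<in> HM_gr k" for k
    using assms by (auto simp: graded_moebius_simps graded_moebius_gr_def in_keys_iff r)
  show ?thesis
  proof (rule ex1I[of _ r])
    let ?K = "{k. r k \<noteq> \<zero>\<^bsub>HM\<^esub>}"
    have "k \<in> matroid_rank M ` Poly_Mapping.keys f" if "k \<in> ?K" for k
    proof -
      have "r k \<noteq> 0" using that by (simp add: graded_moebius_simps)
      then obtain F where "Poly_Mapping.lookup (r k) F \<noteq> 0" by (metis lookup_zero poly_mapping_eqI)
      then show ?thesis by (auto simp: r in_keys_iff)
    qed
    then have finK: "finite ?K" by (meson finite_imageI finite_keys finite_subset subsetI)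
    have "f = (\<Sum>k\<in>?K. r k)"
    proof (rule poly_mapping_eqI)
      fix F
      have "Poly_Mapping.lookup (\<Sum>k\<in>?K. r k) F =
          (if matroid_rank M F \<in> ?K then Poly_Mapping.lookup f F else 0)"
        using finK by (simp add: lookup_sum r when_def)
      moreover have "Poly_Mapping.lookup f F = 0" if "matroid_rank M F \<notin> ?K"
        using that r[of "matroid_rank M F" F] by (simp add: graded_moebius_simps)
      ultimately show "Poly_Mapping.lookup f F = Poly_Mapping.lookup (\<Sum>k\<in>?K. r k) F" by auto
    qed
    also have "\<dots> = finsum HM r ?K" by (rule HM_finsum[symmetric]) (rule gr_carrier[OF r_gr])
    finally show "(\<forall>k. r k \<in> HM_gr k) \<and> finite ?K \<and> f = finsum HM r ?K"
      using r_gr finK by blast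
  next
    fix c assume c: "(\<forall>k. c k \<in> HM_gr k) \<and> finite {k. c k \<noteq> \<zero>\<^bsub>HM\<^esub>} \<and>
      f = finsum HM c {k. c k \<noteq> \<zero>\<^bsub>HM\<^esub>}"
    let ?K = "{k. c k \<noteq> \<zero>\<^bsub>HM\<^esub>}"
    have f: "f = (\<Sum>k\<in>?K. c k)" using c gr_carrier HM_finsum[of ?K c] by metis
    have zero: "Poly_Mapping.lookup (c k) F = 0" if "matroid_rank M F \<noteq> k" for k F
    proof -
      have "Poly_Mapping.keys (c k) \<subseteq> {F \<in> M. matroid_rank M F = k}"
        using c by (auto simp: graded_moebius_gr_def)
      then have "F \<notin> Poly_Mapping.keys (c k)" using that by blast
      then show ?thesis by (simp add: in_keys_iff)
    qed
    show "c = r"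
    proof (intro ext poly_mapping_eqI)
      fix k F
      have "Poly_Mapping.lookup f F =
          (\<Sum>j\<in>?K. if j = matroid_rank M F then Poly_Mapping.lookup (c j) F else 0)"
        by (subst f) (auto simp: lookup_sum zero intro!: sum.cong)
      \<comment> \<open>If the rank of F is not in the index set, that component is zero, so both
        sides vanish.\<close>
      also have "\<dots> = Poly_Mapping.lookup (c (matroid_rank M F)) F"
        using c by (auto simp: graded_moebius_simps)
      finally show "Poly_Mapping.lookup (c k) F = Poly_Mapping.lookup (r k) F"
        using zero by (auto simp: r when_def)
    qed
  qed
qed

lemma graded_algebra_HM: "graded_algebra rat_ring HM HM_gr"
proof (intro graded_algebra.intro graded_algebra_axioms.intro)
  show "algebra rat_ring HM" by (rule algebra_HM)
  interpret algebra rat_ring HM by (rule algebra_HM)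
  show "submodule (HM_gr k) rat_ring HM" for k
  proof (rule submoduleI_smult)
    show "f \<oplus>\<^bsub>HM\<^esub> g \<in> HM_gr k" if "f \<in> HM_gr k" "g \<in> HM_gr k" for f g
      using that keys_add[of f g] by (auto simp: graded_moebius_gr_def graded_moebius_simps)
    show "a \<odot>\<^bsub>HM\<^esub> f \<in> HM_gr k" if "f \<in> HM_gr k" for a f
      using that keys_map_times[of a f] by (auto simp: graded_moebius_gr_def graded_moebius_simps)
  qed (auto simp: graded_moebius_gr_def graded_moebius_simps)
  show "\<one>\<^bsub>HM\<^esub> \<in> HM_gr 0"
    by (simp add: graded_moebius_gr_def graded_moebius_simps cl_flat)
  show "f \<otimes>\<^bsub>HM\<^esub> g \<in> HM_gr (i + j)" if "f \<in> HM_gr i" "g \<in> HM_gr j" for f g i j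
    unfolding graded_moebius_simps moebius_mult_def graded_moebius_gr_def mem_Collect_eq
  proof (intro keys_sum_subset)
    fix F G assume "F \<in> Poly_Mapping.keys f" "G \<in> Poly_Mapping.keys g"
    then have FG: "F \<in> M" "G \<in> M" "matroid_rank M F = i" "matroid_rank M G = j"
      using that unfolding graded_moebius_gr_def by blast+
    \<comment> \<open>A product of symbols survives only where the ranks add up, so the branch
      condition gives its degree.\<close>
    then show "Poly_Mapping.keys (if matroid_rank M F + matroid_rank M G = matroid_rank M (flat_join M F G)
        then Poly_Mapping.single (flat_join M F G) (Poly_Mapping.lookup f F * Poly_Mapping.lookup g G)
        else 0) \<subseteq> {H \<in> M. matroid_rank M H = i + j}"
      using flat_join_flat[OF FG(1,2)] by simp
  qed
qed (rule HM_gr_direct_sum)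

text \<open>A basis of a flat of rank k has k elements, so its product is homogeneous of degree
  k.\<close>

lemma moebius_to_chow_graded:
  assumes "f \<in> HM_gr k"
  shows "\<phi> f \<in> CH_gr k"
proof -
  have f: "f \<in> carrier HM" "\<And>F. F \<in> Poly_Mapping.keys f \<Longrightarrow> F \<in> M \<and> matroid_rank M F = k"
    using assms by (auto simp: graded_moebius_gr_def graded_moebius_simps)
  have "lift f \<in> homogeneous_mpolys (chow_vars E M) k"
    unfolding lift_eq
  proof (rule homogeneous_mpolys_sum)
    fix F assume "F \<in> Poly_Mapping.keys f"
    then have F: "F \<in> M" "matroid_rank M F = k" using f(2) by auto
    note B = flat_basisD[OF chosen_basis[OF F(1)]]
    have "y_flat F \<in> homogeneous_mpolys (chow_vars E M) k"
      using y_prod_homogeneous[OF B(7,4)] B(6) F(2) by simp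
    then show "mpoly_const (Poly_Mapping.lookup f F) * y_flat F \<in> homogeneous_mpolys (chow_vars E M) k"
      using homogeneous_mpolys_mult[OF homogeneous_mpolys_const] by fastforce
  qed
  then show ?thesis using f(1) by (auto simp: moebius_to_chow_eq CH_gr_iff)
qed

lemma graded_algebra_hom_moebius_to_chow: "graded_algebra_hom rat_ring HM HM_gr CH CH_gr \<phi>"
proof (intro graded_algebra_hom.intro graded_algebra_hom_axioms.intro)
  show "\<phi> \<in> ring_hom HM CH"
    by (rule ring_hom_memI)
      (simp_all add: graded_moebius_simps(2-) moebius_to_chow_carrier moebius_to_chow_add
        moebius_to_chow_mult moebius_to_chow_one)
qed (simp_all add: graded_algebra_HM graded_algebra_CH moebius_to_chow_graded moebius_to_chow_smult
    graded_moebius_simps(2-))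

end

theorem proposition2p15:
  fixes E :: "'a set" and M :: "'a set set"
  assumes "loopless_matroid E M"
  shows "graded_algebra_hom rat_ring
           (graded_moebius M) (graded_moebius_gr M)
           (augmented_chow E M) (augmented_chow_gr E M)
           (moebius_to_chow E M)
       \<and> inj_on (moebius_to_chow E M) (carrier (graded_moebius M))"
proof -
  interpret loopless_matroid E M by (rule assms)
  show ?thesis using graded_algebra_hom_moebius_to_chow moebius_to_chow_inj by blast
qed

end
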